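(* Let $X=(\Phi,\Psi)$ be a real analytic planar vector field near the origin of $\mathbb{R}^2$ for which the axis $\{y=0\}$ is invariant, i.e. $\Psi(x,y)=y\,G(x,y)$ with $G$ analytic. Assume $X(0)=0$, that $J=DX(0)$ is nilpotent and nonzero, and that the origin is an isolated equilibrium. Then: (i) $\Phi_x(0)=0$, $\Phi_y(0)\neq0$, $G(0)=0$, and $\ker J=\mathbb{R}\,(1,0)^T$ (so the kernel line is tangent to the invariant axis). (ii) Along the axis, $\det DX(x,0)=\Phi_x(x,0)\,G(x,0)$, which vanishes at $x=0$ to order at least two. (iii) Consequently, with $q_0=(1,0)^T$, $$a:=-\tfrac12\,D_{q_0}\bigl(\det DX\bigr)(0)=0,\qquad b:=D_{q_0}\bigl(\operatorname{tr}DX\bigr)(0)=\Phi_{xx}(0)+G_x(0).$$ (iv) The local multiplicity satisfies $$\mu_0(X)=\operatorname{ord}_x\Phi(x,0)+I_0(\Phi,G)\;\ge\;3 .$$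
   Context: $DX$ is the Jacobian matrix of $X$; $D_q h(p)=\langle\nabla h(p),q\rangle$. $\operatorname{ord}_x h(x)$ is the order of vanishing at $x=0$ of a one-variable power series $h$. For $f,g\in\mathbb{C}\{x,y\}$ (convergent power series), $I_0(f,g)=\dim_{\mathbb{C}}\mathbb{C}\{x,y\}/(f,g)$ is the local intersection number at the origin. The local multiplicity of the equilibrium at the origin is $\mu_0(X)=I_0(\Phi,\Psi)$. *)

theory Defs
  imports "HOL-Analysis.Analysis" "HOL-Algebra.Embedded_Algebras" "HOL-Algebra.QuotRing"
begin

unbundle no fps_syntax and vec_syntax

section \<open>Real analytic functions of two variables near the origin\<close>

text \<open>A bivariate power series is an element of \<open>\<bbbK>[[x]][[y]]\<close>, of type \<open>'a fps fps\<close>: the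
  coefficient of \<open>x^i y^j\<close> in \<open>F\<close> is \<open>coeff2 F i j\<close>.\<close>

definition coeff2 :: "'a::zero fps fps \<Rightarrow> nat \<Rightarrow> nat \<Rightarrow> 'a" where
  "coeff2 F i j = fps_nth (fps_nth F j) i"

definition has_taylor2 :: "(real^2 \<Rightarrow> real) \<Rightarrow> real fps fps \<Rightarrow> bool" where
  "has_taylor2 f F \<longleftrightarrow> (\<exists>r>0. \<forall>p. \<bar>p $ 1\<bar> < r \<and> \<bar>p $ 2\<bar> < r \<longrightarrow>
     ((\<lambda>(i, j). coeff2 F i j * (p $ 1) ^ i * (p $ 2) ^ j) has_sum f p) UNIV)"

definition analytic_at_origin :: "(real^2 \<Rightarrow> real) \<Rightarrow> bool" where
  "analytic_at_origin f \<longleftrightarrow> (\<exists>F. has_taylor2 f F)"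

definition taylor2 :: "(real^2 \<Rightarrow> real) \<Rightarrow> real fps fps" where
  "taylor2 f = (THE F. has_taylor2 f F)"

definition partial :: "2 \<Rightarrow> (real^2 \<Rightarrow> real) \<Rightarrow> real^2 \<Rightarrow> real" where
  "partial i f p = deriv (\<lambda>t. f (p + t *\<^sub>R axis i 1)) 0"

definition gradient :: "(real^2 \<Rightarrow> real) \<Rightarrow> real^2 \<Rightarrow> real^2" where
  "gradient h p = (THE D. GDERIV h p :> D)"

definition dir_deriv :: "real^2 \<Rightarrow> (real^2 \<Rightarrow> real) \<Rightarrow> real^2 \<Rightarrow> real" where
  "dir_deriv q h p = gradient h p \<bullet> q"

text \<open>Powers are spelled out with \<open>**\<close>, since \<open>*\<close> and \<open>^\<close> on \<open>real^'n^'n\<close> would act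
  componentwise.\<close>

definition nilpotent_matrix :: "real^'n^'n \<Rightarrow> bool" where
  "nilpotent_matrix A \<longleftrightarrow> (\<exists>k. (((**) A) ^^ k) (mat 1) = 0)"

section \<open>Order of vanishing in one variable\<close>

definition fps_ord :: "'a::zero fps \<Rightarrow> enat" where
  "fps_ord F = (if F = 0 then \<infinity> else enat (subdegree F))"

definition ord_at_0 :: "(real \<Rightarrow> real) \<Rightarrow> enat" where
  "ord_at_0 h = fps_ord (THE F. h has_fps_expansion F)"

section \<open>The ring of convergent power series and local intersection numbers\<close>

definition convergent2 :: "complex fps fps \<Rightarrow> bool" where
  "convergent2 F \<longleftrightarrow> (\<exists>r>0. (\<lambda>(i, j). norm (coeff2 F i j) * r ^ i * r ^ j) summable_on UNIV)"

definition conv_ring :: "complex fps fps ring" where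
  "conv_ring = \<lparr>carrier = {F. convergent2 F}, mult = (*), one = 1, zero = 0, add = (+)\<rparr>"

definition local_algebra :: "complex fps fps \<Rightarrow> complex fps fps \<Rightarrow> complex fps fps set ring" where
  "local_algebra f g = conv_ring Quot (Idl\<^bsub>conv_ring\<^esub> {f, g})"

text \<open>The image of the constants \<open>\<complex>\<close> in the quotient; it is a field unless the quotient is
  the zero ring, whose dimension is \<open>0\<close>.\<close>

definition local_scalars :: "complex fps fps \<Rightarrow> complex fps fps \<Rightarrow> complex fps fps set set" where
  "local_scalars f g =
     range (\<lambda>c. Idl\<^bsub>conv_ring\<^esub> {f, g} +>\<^bsub>conv_ring\<^esub> fps_const (fps_const c))"

definition intersection_number :: "complex fps fps \<Rightarrow> complex fps fps \<Rightarrow> enat" where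
  "intersection_number f g =
     (let is_dim = (\<lambda>n. ring.dimension (local_algebra f g) n (local_scalars f g)
                          (carrier (local_algebra f g)))
      in if \<exists>n. is_dim n then enat (THE n. is_dim n) else \<infinity>)"

definition complexify :: "real fps fps \<Rightarrow> complex fps fps" where
  "complexify F = Abs_fps (\<lambda>j. Abs_fps (\<lambda>i. complex_of_real (coeff2 F i j)))"

text \<open>The intersection number of two real analytic germs, viewed in \<open>\<complex>{x,y}\<close>.\<close>

definition I\<^sub>0 :: "(real^2 \<Rightarrow> real) \<Rightarrow> (real^2 \<Rightarrow> real) \<Rightarrow> enat" where
  "I\<^sub>0 f g = intersection_number (complexify (taylor2 f)) (complexify (taylor2 g))"

definition \<mu>\<^sub>0 :: "(real^2 \<Rightarrow> real^2) \<Rightarrow> enat" where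
  "\<mu>\<^sub>0 X = I\<^sub>0 (\<lambda>p. X p $ 1) (\<lambda>p. X p $ 2)"

section \<open>Power series expansions are unique\<close>

text \<open>Hence the definite descriptions in \<open>taylor2\<close> and \<open>ord_at_0\<close> denote.\<close>

lemma fps_eq_0_if_eval_eq_0:
  fixes F :: "real fps"
  assumes "fps_conv_radius F > 0" "\<forall>\<^sub>F z in nhds 0. eval_fps F z = 0"
  shows "F = 0"
proof (rule ccontr)
  assume "F \<noteq> 0"
  define n where "n = subdegree F"
  define H where "H = fps_shift n F"
  have r: "fps_conv_radius H > 0" using assms(1) by (simp add: H_def)
  have "isCont (eval_fps H) 0"
    using r by (intro continuous_eval_fps) (auto simp: zero_ereal_def)
  hence lim: "(eval_fps H \<longlongrightarrow> eval_fps H 0) (at 0)" by (simp add: isCont_def)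
  have "\<forall>\<^sub>F z in nhds 0. z \<in> eball 0 (fps_conv_radius F)"
    using assms(1) by (intro eventually_nhds_in_open) (auto simp: zero_ereal_def)
  hence "\<forall>\<^sub>F z in nhds 0. z \<noteq> 0 \<longrightarrow> eval_fps H z = 0"
    using assms(2) by eventually_elim (auto simp: H_def n_def eval_fps_shift)
  hence "\<forall>\<^sub>F z in at 0. eval_fps H z = 0" by (auto simp: eventually_at_filter)
  hence "(eval_fps H \<longlongrightarrow> 0) (at 0)" by (rule tendsto_eventually)
  from tendsto_unique[OF _ lim this] have "eval_fps H 0 = 0" by simp
  thus False using \<open>F \<noteq> 0\<close> by (simp add: eval_fps_at_0 H_def n_def)
qed

lemma has_fps_expansion_unique_real:
  fixes F H :: "real fps"
  assumes "h has_fps_expansion F" "h has_fps_expansion H"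
  shows "F = H"
proof -
  have "(\<lambda>x. h x - h x) has_fps_expansion (F - H)"
    using assms by (intro has_fps_expansion_diff)
  thus ?thesis using fps_eq_0_if_eval_eq_0[of "F - H"] by (simp add: has_fps_expansion_def)
qed

lemma powser_has_sum_unique:
  fixes a b :: "nat \<Rightarrow> real"
  assumes "r > 0"
    and a: "\<And>x. \<bar>x\<bar> < r \<Longrightarrow> ((\<lambda>n. a n * x ^ n) has_sum h x) UNIV"
    and b: "\<And>x. \<bar>x\<bar> < r \<Longrightarrow> ((\<lambda>n. b n * x ^ n) has_sum h x) UNIV"
  shows "a = b"
proof -
  have *: "h has_fps_expansion Abs_fps c"
    if c: "\<And>x. \<bar>x\<bar> < r \<Longrightarrow> ((\<lambda>n. c n * x ^ n) has_sum h x) UNIV" for c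
    unfolding has_fps_expansion_def
  proof
    have "summable (\<lambda>n. c n * (r / 2) ^ n)"
      using has_sum_imp_sums[OF c[of "r / 2"]] \<open>r > 0\<close> by (auto simp: sums_iff)
    hence "ereal (norm (r / 2)) \<le> conv_radius c" by (rule conv_radius_geI)
    moreover have "0 < ereal (norm (r / 2))" using \<open>r > 0\<close> by simp
    ultimately have "0 < conv_radius c" by (rule order_less_le_trans[rotated])
    thus "fps_conv_radius (Abs_fps c) > 0" by (simp add: fps_conv_radius_def)
    have "\<forall>\<^sub>F x in nhds 0. x \<in> ball 0 r" using \<open>r > 0\<close> by (intro eventually_nhds_in_open) auto
    thus "\<forall>\<^sub>F x in nhds 0. eval_fps (Abs_fps c) x = h x"
    proof eventually_elim
      case (elim x)
      thus ?case using has_sum_imp_sums[OF c[of x]] by (simp add: eval_fps_def sums_iff)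
    qed
  qed
  have "Abs_fps a = Abs_fps b"
    by (rule has_fps_expansion_unique_real[of h]) (rule *[OF a] *[OF b]; assumption)+
  thus ?thesis by (metis fps_nth_Abs_fps ext)
qed

lemma has_taylor2_unique:
  assumes "has_taylor2 f F" "has_taylor2 f H"
  shows "F = H"
proof -
  obtain r where r: "r > 0" and F: "\<And>p. \<bar>p $ 1\<bar> < r \<Longrightarrow> \<bar>p $ 2\<bar> < r \<Longrightarrow>
       ((\<lambda>(i, j). coeff2 F i j * (p $ 1) ^ i * (p $ 2) ^ j) has_sum f p) UNIV"
    and H: "\<And>p. \<bar>p $ 1\<bar> < r \<Longrightarrow> \<bar>p $ 2\<bar> < r \<Longrightarrow>
       ((\<lambda>(i, j). coeff2 H i j * (p $ 1) ^ i * (p $ 2) ^ j) has_sum f p) UNIV"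
  proof -
    from assms obtain r s where "r > 0" "s > 0"
       "\<forall>p. \<bar>p $ 1\<bar> < r \<and> \<bar>p $ 2\<bar> < r \<longrightarrow>
     ((\<lambda>(i, j). coeff2 F i j * (p $ 1) ^ i * (p $ 2) ^ j) has_sum f p) UNIV"
       "\<forall>p. \<bar>p $ 1\<bar> < s \<and> \<bar>p $ 2\<bar> < s \<longrightarrow>
     ((\<lambda>(i, j). coeff2 H i j * (p $ 1) ^ i * (p $ 2) ^ j) has_sum f p) UNIV"
      by (auto simp: has_taylor2_def)
    thus ?thesis by (intro that[of "min r s"]) auto
  qed
  define row where "row K x j = (\<Sum>\<^sub>\<infinity>i. coeff2 K i j * x ^ i)" for K and x :: real and j
  have row: "((\<lambda>j. row K x j * y ^ j) has_sum f (vector [x, y])) UNIV"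
       "((\<lambda>i. coeff2 K i j * x ^ i) has_sum row K x j) UNIV"
    if K: "\<And>p. \<bar>p $ 1\<bar> < r \<Longrightarrow> \<bar>p $ 2\<bar> < r \<Longrightarrow>
       ((\<lambda>(i, j). coeff2 K i j * (p $ 1) ^ i * (p $ 2) ^ j) has_sum f p) UNIV"
      and xy: "\<bar>x\<bar> < r" "\<bar>y\<bar> < r" for K x y j
  proof -
    have swap: "((\<lambda>(j, i). coeff2 K i j * x ^ i * y' ^ j) has_sum f (vector [x, y'])) (UNIV \<times> UNIV)"
      if "\<bar>y'\<bar> < r" for y'
      using K[of "vector [x, y']"] xy that
        has_sum_reindex_bij_betw[OF bij_swap,
          of "\<lambda>(i, j). coeff2 K i j * x ^ i * y' ^ j" "f (vector [x, y'])"]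
      by (simp add: case_prod_unfold)
    have s: "(\<lambda>i. coeff2 K i j * x ^ i) summable_on UNIV" for j
    proof -
      have "(\<lambda>(j, i). coeff2 K i j * x ^ i * (r / 2) ^ j) summable_on (UNIV \<times> UNIV)"
        using swap[of "r / 2"] r has_sum_imp_summable by fastforce
      from summable_on_SigmaD1[OF this, of j]
      have "(\<lambda>i. coeff2 K i j * x ^ i * (r / 2) ^ j) summable_on UNIV" by simp
      from summable_on_cmult_left[OF this, of "inverse ((r / 2) ^ j)"]
      show ?thesis using r by (simp add: field_simps)
    qed
    show 2: "((\<lambda>i. coeff2 K i j * x ^ i) has_sum row K x j) UNIV" for j
      using s unfolding row_def by (rule has_sum_infsum)
    show "((\<lambda>j. row K x j * y ^ j) has_sum f (vector [x, y])) UNIV"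
    proof (rule has_sum_SigmaD[OF swap[OF xy(2)]])
      fix j show "((\<lambda>i. case (j, i) of (j, i) \<Rightarrow> coeff2 K i j * x ^ i * y ^ j) has_sum
          row K x j * y ^ j) UNIV"
        using has_sum_cmult_left[OF 2] by simp
    qed
  qed
  have rows: "row F x = row H x" if "\<bar>x\<bar> < r" for x
    by (rule powser_has_sum_unique[OF r, of _ "\<lambda>y. f (vector [x, y])"])
       (use row(1)[OF F that] row(1)[OF H that] in auto)
  have "(\<lambda>i. coeff2 F i j) = (\<lambda>i. coeff2 H i j)" for j
    by (rule powser_has_sum_unique[OF r, of _ "\<lambda>x. row F x j"])
       (use row(2)[OF F, of _ 0] row(2)[OF H, of _ 0] rows r in auto)
  thus ?thesis by (auto simp: fps_eq_iff coeff2_def fun_eq_iff)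
qed

end

theory Submission
  imports Defs
begin

text \<open>
  Everything is read off from the Taylor series of \<open>\<Phi>\<close>, \<open>\<Psi>\<close> and \<open>G\<close> at the origin; the relation
  \<open>\<Psi> = y G\<close> becomes an identity between the series by uniqueness. On the invariant axis \<open>\<Psi>\<^sub>x = 0\<close> and
  \<open>\<Psi>\<^sub>y = G\<close>, so the Jacobian matrix is upper triangular there with diagonal entries \<open>\<Phi>\<^sub>x\<close> and \<open>G\<close>.
  At the origin nilpotency kills both diagonal entries and the remaining entry \<open>\<Phi>\<^sub>y(0)\<close> must be
  nonzero. Along the axis the determinant is the product of two functions vanishing at \<open>0\<close>,
  whence its order is at least two and its derivative in the direction of the axis is zero.

  These arguments need analytic germs, given as sums of double power series, to be Frechet
  differentiable with partial derivatives that are again analytic (\<open>eval2_has_derivative\<close>,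
  \<open>has_taylor2_partial_1\<close>, \<open>has_taylor2_partial_2\<close>). Cauchy estimates on the coefficients reduce
  this to the Weierstrass test with a geometric majorant.

  For the multiplicity let \<open>R\<close> be the ring of convergent series. If \<open>f(x, 0) \<noteq> 0\<close>, the sequence
  \<open>0 \<rightarrow> R/(f, g) \<rightarrow> R/(f, y g) \<rightarrow> R/(f, y) \<rightarrow> 0\<close>, whose first map is multiplication by \<open>y\<close>, is exact:
  if \<open>y x = a f + b y g\<close>, then \<open>a(x, 0) f(x, 0) = 0\<close>, hence \<open>y\<close> divides \<open>a\<close> and cancels
  (\<open>ideal2_y_mult_quotient\<close>, \<open>ideal2_y_mult_sum\<close>). The third term is \<open>\<complex>{x}/(f(x, 0))\<close>, of dimension
  \<open>ord f(x, 0)\<close> (\<open>ideal2_y_eq\<close>, \<open>rel_dim_vanishing_on_axis\<close>). Additivity of dimension gives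
  \<open>I(f, y g) = ord f(x, 0) + I(f, g)\<close>, including the case of infinite dimension
  (\<open>intersection_number_y_mult\<close>). For \<open>f = \<Phi>\<close> and \<open>g = G\<close> the series \<open>\<Phi>(x, 0)\<close> is nonzero because the
  equilibrium is isolated; its order is at least two because \<open>\<Phi>(0) = \<Phi>\<^sub>x(0) = 0\<close>; and
  \<open>I(\<Phi>, G) \<ge> 1\<close> because both series vanish at the origin, so the ideal is proper.
\<close>

section \<open>Cauchy estimates for double power series\<close>

text \<open>A single Cauchy estimate \<open>|c\<^sub>i\<^sub>j| \<le> C / r\<^sup>i\<^sup>+\<^sup>j\<close> is equivalent to convergence near the origin and,
  unlike summability, passes to sums, products and derivatives by direct estimates. The
  division is avoided by multiplying with the powers of \<open>r\<close>.\<close>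

definition cauchy_bound :: "'a::real_normed_vector fps fps \<Rightarrow> real \<Rightarrow> real \<Rightarrow> bool" where
  "cauchy_bound F C r \<longleftrightarrow> r > 0 \<and> (\<forall>i j. norm (coeff2 F i j) * r ^ i * r ^ j \<le> C)"

lemma summable_on_geometric2: "(\<lambda>(i, j). (1 / 2 :: real) ^ i * (1 / 2) ^ j) summable_on UNIV"
proof -
  have g: "((\<lambda>n. (1 / 2 :: real) ^ n) has_sum 2) UNIV"
    using geometric_sums[of "1 / 2 :: real"] by (intro norm_summable_imp_has_sum) auto
  have "(\<lambda>(i, j). (1 / 2 :: real) ^ i * (1 / 2) ^ j) summable_on UNIV \<times> UNIV"
  proof (rule summable_on_SigmaI)
    show "((\<lambda>j. case (i, j) of (i, j) \<Rightarrow> (1 / 2 :: real) ^ i * (1 / 2) ^ j) has_sum (1 / 2) ^ i * 2) UNIV" for i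
      using has_sum_cmult_right[OF g] by simp
    show "(\<lambda>i. (1 / 2 :: real) ^ i * 2) summable_on UNIV"
      using has_sum_imp_summable[OF g] by (rule summable_on_cmult_left)
  qed auto
  thus ?thesis by simp
qed

text \<open>Halving the radius turns the bounded terms into terms dominated by the double geometric
  series. Termwise differentiation and the convergence of double series rest on this majorant.\<close>

lemma cauchy_bound_halved:
  assumes "cauchy_bound F C r" "\<bar>x\<bar> \<le> r / 2" "\<bar>y\<bar> \<le> r / 2"
  shows "norm (coeff2 F i j) * \<bar>x\<bar> ^ i * \<bar>y\<bar> ^ j \<le> C * ((1 / 2) ^ i * (1 / 2) ^ j)"
proof -
  have r: "r > 0" and b: "norm (coeff2 F i j) * r ^ i * r ^ j \<le> C"
    using assms(1) by (auto simp: cauchy_bound_def)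
  have "norm (coeff2 F i j) * \<bar>x\<bar> ^ i * \<bar>y\<bar> ^ j \<le> norm (coeff2 F i j) * (r / 2) ^ i * (r / 2) ^ j"
    using assms r by (intro mult_mono power_mono) auto
  also have "\<dots> = (norm (coeff2 F i j) * r ^ i * r ^ j) * ((1 / 2) ^ i * (1 / 2) ^ j)"
    by (simp add: power_divide)
  also have "\<dots> \<le> C * ((1 / 2) ^ i * (1 / 2) ^ j)"
    by (intro mult_right_mono b) auto
  finally show ?thesis .
qed

lemma summable_on_imp_cauchy_bound:
  assumes "r > 0" "(\<lambda>(i, j). norm (coeff2 F i j) * r ^ i * r ^ j) summable_on UNIV"
  shows "\<exists>C. cauchy_bound F C r"
proof (intro exI)
  let ?f = "\<lambda>(i, j). norm (coeff2 F i j) * r ^ i * r ^ j"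
  show "cauchy_bound F (infsum ?f UNIV) r"
    unfolding cauchy_bound_def
  proof (intro conjI allI)
    fix i j
    have "sum ?f {(i, j)} \<le> infsum ?f UNIV"
      using assms by (intro finite_sum_le_infsum) auto
    thus "norm (coeff2 F i j) * r ^ i * r ^ j \<le> infsum ?f UNIV" by simp
  qed (use assms in auto)
qed

lemma cauchy_bound_summable_on:
  assumes "cauchy_bound F C r" "\<bar>x\<bar> \<le> r / 2" "\<bar>y\<bar> \<le> r / 2"
  shows "(\<lambda>(i, j). norm (coeff2 F i j) * \<bar>x\<bar> ^ i * \<bar>y\<bar> ^ j) summable_on UNIV"
proof (rule summable_on_comparison_test)
  show "(\<lambda>(i, j). C * ((1 / 2) ^ i * (1 / 2) ^ j)) summable_on UNIV"
    using summable_on_cmult_right[OF summable_on_geometric2, of C] by (simp add: case_prod_unfold)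
qed (use cauchy_bound_halved[OF assms] in auto)

lemma convergent2_iff_cauchy_bound: "convergent2 F \<longleftrightarrow> (\<exists>C r. cauchy_bound F C r)"
proof
  assume "\<exists>C r. cauchy_bound F C r"
  then obtain C r where b: "cauchy_bound F C r" by blast
  hence r: "r > 0" by (simp add: cauchy_bound_def)
  from cauchy_bound_summable_on[OF b, of "r / 2" "r / 2"] r show "convergent2 F"
    by (auto simp: convergent2_def intro!: exI[of _ "r / 2"])
qed (auto simp: convergent2_def dest!: summable_on_imp_cauchy_bound)

lemma has_taylor2_imp_cauchy_bound:
  assumes "has_taylor2 f F"
  shows "\<exists>C r. cauchy_bound F C r"
proof -
  from assms obtain r where r: "r > 0" and s: "\<forall>p. \<bar>p $ 1\<bar> < r \<and> \<bar>p $ 2\<bar> < r \<longrightarrow>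
     ((\<lambda>(i, j). coeff2 F i j * (p $ 1) ^ i * (p $ 2) ^ j) has_sum f p) UNIV"
    by (auto simp: has_taylor2_def)
  from s[rule_format, of "vector [r / 2, r / 2]"] r
  have "(\<lambda>(i, j). coeff2 F i j * (r / 2) ^ i * (r / 2) ^ j) summable_on UNIV"
    by (auto dest: has_sum_imp_summable)
  hence "(\<lambda>q. norm (case q of (i, j) \<Rightarrow> coeff2 F i j * (r / 2) ^ i * (r / 2) ^ j)) summable_on UNIV"
    by (rule summable_on_iff_abs_summable_on_real[THEN iffD1])
  hence "(\<lambda>(i, j). norm (coeff2 F i j) * (r / 2) ^ i * (r / 2) ^ j) summable_on UNIV"
    using r by (simp add: case_prod_unfold abs_mult power_abs)
  thus ?thesis using r summable_on_imp_cauchy_bound[of "r / 2" F] by auto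
qed

section \<open>Termwise differentiation of double power series\<close>

text \<open>In \<open>\<real>[[x]][[y]]\<close> the operator \<open>fps_deriv\<close> is differentiation with respect to the outer variable
  \<open>y\<close>; the derivative with respect to \<open>x\<close> acts on each coefficient.\<close>

definition deriv_x :: "'a::{comm_ring_1} fps fps \<Rightarrow> 'a fps fps" where
  "deriv_x F = Abs_fps (\<lambda>j. fps_deriv (fps_nth F j))"

lemma coeff2_deriv_x: "coeff2 (deriv_x F) i j = of_nat (Suc i) * coeff2 F (Suc i) j"
  by (simp add: coeff2_def deriv_x_def)

lemma coeff2_deriv_y: "coeff2 (fps_deriv F) i j = of_nat (Suc j) * coeff2 F i (Suc j)"
  by (simp add: coeff2_def del: fps_of_nat of_nat_Suc)

lemma Suc_mult_half_power_le: "real (Suc n) * (1 / 2) ^ n \<le> 1"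
proof -
  have "Suc n \<le> 2 ^ n" by (induction n) auto
  hence "real (Suc n) \<le> 2 ^ n" by (metis of_nat_le_iff of_nat_power of_nat_numeral)
  thus ?thesis by (simp add: power_divide field_simps)
qed

text \<open>Differentiation brings in the factor \<open>i + 1\<close>, which a smaller radius absorbs, since
  \<open>(i + 1) / 2\<^sup>i \<le> 1\<close>; the lost degree costs a factor \<open>1 / r\<close>.\<close>

lemma cauchy_bound_deriv_x:
  fixes F :: "real fps fps"
  assumes "cauchy_bound F C r"
  shows "cauchy_bound (deriv_x F) (C / r) (r / 2)"
proof -
  have r: "r > 0" and b: "norm (coeff2 F i j) * r ^ i * r ^ j \<le> C" for i j
    using assms by (auto simp: cauchy_bound_def)
  have C: "0 \<le> C" using b[of 0 0] norm_ge_zero[of "coeff2 F 0 0"] by simp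
  have "norm (coeff2 (deriv_x F) i j) * (r / 2) ^ i * (r / 2) ^ j \<le> C / r" for i j
  proof -
    have "norm (coeff2 (deriv_x F) i j) * (r / 2) ^ i * (r / 2) ^ j
        = (norm (coeff2 F (Suc i) j) * r ^ Suc i * r ^ j / r)
          * ((real (Suc i) * (1 / 2) ^ i) * (1 / 2) ^ j)"
      using r by (simp add: coeff2_deriv_x abs_mult power_divide del: of_nat_Suc)
    also have "\<dots> \<le> (C / r) * (1 * 1)"
      using r b[of "Suc i" j]
      by (intro mult_mono divide_right_mono Suc_mult_half_power_le power_le_one mult_nonneg_nonneg)
         (use C in auto)
    finally show ?thesis by simp
  qed
  thus ?thesis using r by (simp add: cauchy_bound_def)
qed

lemma cauchy_bound_deriv_y:
  fixes F :: "real fps fps"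
  assumes "cauchy_bound F C r"
  shows "cauchy_bound (fps_deriv F) (C / r) (r / 2)"
proof -
  have r: "r > 0" and b: "norm (coeff2 F i j) * r ^ i * r ^ j \<le> C" for i j
    using assms by (auto simp: cauchy_bound_def)
  have C: "0 \<le> C" using b[of 0 0] norm_ge_zero[of "coeff2 F 0 0"] by simp
  have "norm (coeff2 (fps_deriv F) i j) * (r / 2) ^ i * (r / 2) ^ j \<le> C / r" for i j
  proof -
    have "norm (coeff2 (fps_deriv F) i j) * (r / 2) ^ i * (r / 2) ^ j
        = (norm (coeff2 F i (Suc j)) * r ^ i * r ^ Suc j / r)
          * ((real (Suc j) * (1 / 2) ^ j) * (1 / 2) ^ i)"
      using r by (simp add: coeff2_deriv_y abs_mult power_divide mult_ac del: of_nat_Suc)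
    also have "\<dots> \<le> (C / r) * (1 * 1)"
      using r b[of i "Suc j"]
      by (intro mult_mono divide_right_mono Suc_mult_half_power_le power_le_one mult_nonneg_nonneg)
         (use C in auto)
    finally show ?thesis by simp
  qed
  thus ?thesis using r by (simp add: cauchy_bound_def)
qed

definition eval2 :: "real fps fps \<Rightarrow> real^2 \<Rightarrow> real" where
  "eval2 F p = (\<Sum>\<^sub>\<infinity>(i, j). coeff2 F i j * (p $ 1) ^ i * (p $ 2) ^ j)"

lemma eval2_has_sum:
  assumes "cauchy_bound F C r" "\<bar>p $ 1\<bar> \<le> r / 2" "\<bar>p $ 2\<bar> \<le> r / 2"
  shows "((\<lambda>(i, j). coeff2 F i j * (p $ 1) ^ i * (p $ 2) ^ j) has_sum eval2 F p) UNIV"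
proof -
  have "(\<lambda>q. norm (case q of (i, j) \<Rightarrow> coeff2 F i j * (p $ 1) ^ i * (p $ 2) ^ j)) summable_on UNIV"
    using cauchy_bound_summable_on[OF assms]
    by (simp add: case_prod_unfold abs_mult power_abs)
  thus ?thesis unfolding eval2_def
    by (intro has_sum_infsum) (rule summable_on_iff_abs_summable_on_real[THEN iffD2])
qed

lemma has_taylor2_eval2:
  assumes "cauchy_bound F C r"
  shows "has_taylor2 (eval2 F) F"
  using eval2_has_sum[OF assms] assms
  by (auto simp: has_taylor2_def cauchy_bound_def intro!: exI[of _ "r / 2"])

text \<open>Taylor expansions are required on squares, limits and derivatives use round
  neighbourhoods; both describe the same germs.\<close>

lemma eventually_nhds_0_square:
  "(\<forall>\<^sub>F p in nhds (0 :: real^2). P p) \<longleftrightarrow> (\<exists>r>0. \<forall>p. \<bar>p $ 1\<bar> < r \<and> \<bar>p $ 2\<bar> < r \<longrightarrow> P p)"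
proof
  assume "\<forall>\<^sub>F p in nhds (0 :: real^2). P p"
  then obtain d where d: "d > 0" "\<And>p. dist p 0 < d \<Longrightarrow> P p" by (auto simp: eventually_nhds_metric)
  have "dist p 0 < d" if "\<bar>p $ 1\<bar> < d / 2" "\<bar>p $ 2\<bar> < d / 2" for p :: "real^2"
    using norm_le_l1_cart[of p] that by (simp add: sum_2)
  thus "\<exists>r>0. \<forall>p. \<bar>p $ 1\<bar> < r \<and> \<bar>p $ 2\<bar> < r \<longrightarrow> P p"
    using d by (intro exI[of _ "d / 2"]) auto
next
  assume "\<exists>r>0. \<forall>p. \<bar>p $ 1\<bar> < r \<and> \<bar>p $ 2\<bar> < r \<longrightarrow> P p"
  then obtain r where r: "r > 0" "\<And>p. \<bar>p $ 1\<bar> < r \<Longrightarrow> \<bar>p $ 2\<bar> < r \<Longrightarrow> P p" by blast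
  have "P p" if "dist p 0 < r" for p :: "real^2"
  proof (rule r(2))
    show "\<bar>p $ 1\<bar> < r" "\<bar>p $ 2\<bar> < r"
      using that component_le_norm_cart[of p 1] component_le_norm_cart[of p 2] by simp_all
  qed
  thus "\<forall>\<^sub>F p in nhds (0 :: real^2). P p"
    unfolding eventually_nhds_metric using r(1) by blast
qed

lemma has_taylor2_cong:
  assumes "\<forall>\<^sub>F p in nhds 0. f p = g p" "has_taylor2 f F"
  shows "has_taylor2 g F"
proof -
  from assms(2) have "\<forall>\<^sub>F p in nhds (0 :: real^2). ((\<lambda>(i, j). coeff2 F i j * (p $ 1) ^ i * (p $ 2) ^ j) has_sum f p) UNIV"
    by (simp add: has_taylor2_def eventually_nhds_0_square)
  with assms(1) have "\<forall>\<^sub>F p in nhds (0 :: real^2). ((\<lambda>(i, j). coeff2 F i j * (p $ 1) ^ i * (p $ 2) ^ j) has_sum g p) UNIV"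
    by eventually_elim simp
  thus ?thesis by (simp add: has_taylor2_def eventually_nhds_0_square)
qed

lemma has_taylor2_eventually_eval2:
  assumes "has_taylor2 f F"
  shows "\<forall>\<^sub>F p in nhds 0. f p = eval2 F p"
proof -
  from assms have "\<forall>\<^sub>F p in nhds (0 :: real^2).
      ((\<lambda>(i, j). coeff2 F i j * (p $ 1) ^ i * (p $ 2) ^ j) has_sum f p) UNIV"
    by (simp add: has_taylor2_def eventually_nhds_0_square)
  thus ?thesis by eventually_elim (simp add: eval2_def infsumI)
qed

text \<open>The derivative of the term with index \<open>(i, j)\<close> is the term of the differentiated series with
  index \<open>(i - 1, j)\<close>; the terms with \<open>i = 0\<close> contribute nothing, so reindexing is harmless.\<close>

lemma eval2_termwise_deriv_x:
  assumes b: "cauchy_bound F C r" and p: "\<bar>p $ 1\<bar> \<le> r / 4" "\<bar>p $ 2\<bar> \<le> r / 4"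
  shows "((\<lambda>(i, j). coeff2 F i j * (of_nat i * (p $ 1) ^ (i - 1)) * (p $ 2) ^ j) has_sum eval2 (deriv_x F) p) UNIV"
    (is "(?g has_sum _) _")
proof -
  have "((\<lambda>(i, j). coeff2 (deriv_x F) i j * (p $ 1) ^ i * (p $ 2) ^ j) has_sum eval2 (deriv_x F) p) UNIV"
    using p by (intro eval2_has_sum[OF cauchy_bound_deriv_x[OF b]]) auto
  hence "((?g \<circ> map_prod Suc id) has_sum eval2 (deriv_x F) p) UNIV"
    by (simp add: o_def case_prod_unfold coeff2_deriv_x mult_ac)
  hence "(?g has_sum eval2 (deriv_x F) p) (range (map_prod Suc id))"
    by (subst has_sum_reindex) (auto intro!: injI)
  moreover have *: "?g q = 0" if "q \<notin> range (map_prod Suc id)" for q :: "nat \<times> nat"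
  proof (cases q)
    case (Pair i j)
    show ?thesis
    proof (cases i)
      case (Suc i')
      hence "q = map_prod Suc id (i', j)" using Pair by simp
      with that show ?thesis by blast
    qed (use Pair in simp)
  qed
  have "(?g has_sum s) UNIV \<longleftrightarrow> (?g has_sum s) (range (map_prod Suc id))" for s
    by (rule has_sum_cong_neutral) (use * in auto)
  ultimately show ?thesis by simp
qed

lemma eval2_termwise_deriv_y:
  assumes b: "cauchy_bound F C r" and p: "\<bar>p $ 1\<bar> \<le> r / 4" "\<bar>p $ 2\<bar> \<le> r / 4"
  shows "((\<lambda>(i, j). coeff2 F i j * (p $ 1) ^ i * (of_nat j * (p $ 2) ^ (j - 1))) has_sum eval2 (fps_deriv F) p) UNIV"
    (is "(?g has_sum _) _")
proof -
  have "((\<lambda>(i, j). coeff2 (fps_deriv F) i j * (p $ 1) ^ i * (p $ 2) ^ j) has_sum eval2 (fps_deriv F) p) UNIV"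
    using p by (intro eval2_has_sum[OF cauchy_bound_deriv_y[OF b]]) auto
  hence "((?g \<circ> map_prod id Suc) has_sum eval2 (fps_deriv F) p) UNIV"
    by (simp add: o_def case_prod_unfold coeff2_deriv_y mult_ac)
  hence "(?g has_sum eval2 (fps_deriv F) p) (range (map_prod id Suc))"
    by (subst has_sum_reindex) (auto intro!: injI)
  moreover have *: "?g q = 0" if "q \<notin> range (map_prod id Suc)" for q :: "nat \<times> nat"
  proof (cases q)
    case (Pair i j)
    show ?thesis
    proof (cases j)
      case (Suc j')
      hence "q = map_prod id Suc (i, j')" using Pair by simp
      with that show ?thesis by blast
    qed (use Pair in simp)
  qed
  have "(?g has_sum s) UNIV \<longleftrightarrow> (?g has_sum s) (range (map_prod id Suc))" for s
    by (rule has_sum_cong_neutral) (use * in auto)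
  ultimately show ?thesis by simp
qed

text \<open>Both partial derivatives are obtained at once by differentiating a simple series termwise:
  the double series is enumerated by the pairing function, and the Weierstrass test makes the
  series of the \<open>x\<close>- and \<open>y\<close>-derivatives converge uniformly on a square.\<close>

lemma eval2_has_derivative:
  assumes b: "cauchy_bound F C r" and p: "\<bar>p $ 1\<bar> < r / 4" "\<bar>p $ 2\<bar> < r / 4"
  shows "(eval2 F has_derivative (\<lambda>h. eval2 (deriv_x F) p * h $ 1 + eval2 (fps_deriv F) p * h $ 2)) (at p)"
proof -
  define S :: "(real^2) set" where "S = box (vector [- (r / 4), - (r / 4)]) (vector [r / 4, r / 4])"
  have S_iff: "q \<in> S \<longleftrightarrow> \<bar>q $ 1\<bar> < r / 4 \<and> \<bar>q $ 2\<bar> < r / 4" for q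
    by (auto simp: S_def mem_box_cart forall_2)
  have pS: "p \<in> S" using p by (simp add: S_iff)
  have r: "r > 0" using b by (simp add: cauchy_bound_def)
  define f gx gy where "f = (\<lambda>(i, j) (q :: real^2). coeff2 F i j * (q $ 1) ^ i * (q $ 2) ^ j)"
    and "gx = (\<lambda>(i, j) (q :: real^2). coeff2 F i j * (of_nat i * (q $ 1) ^ (i - 1)) * (q $ 2) ^ j)"
    and "gy = (\<lambda>(i, j) (q :: real^2). coeff2 F i j * (q $ 1) ^ i * (of_nat j * (q $ 2) ^ (j - 1)))"
  \<comment> \<open>Differentiation lowers the degree by one, so the majorant of the differentiated series,
    \<open>(C / r) (1/2)\<^sup>i\<^sup>+\<^sup>j\<close>, is shifted by one index; the factor \<open>2\<close> compensates.\<close>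
  define M where "M = (\<lambda>(i, j). 2 * C / r * ((1 / 2 :: real) ^ i * (1 / 2) ^ j))"
  have C: "0 \<le> C"
    using b by (auto simp: cauchy_bound_def dest!: spec[of _ 0] intro: order_trans[OF norm_ge_zero])
  have sums: "(\<lambda>n. t (prod_decode n)) sums s" if "(t has_sum s) UNIV" for t :: "nat \<times> nat \<Rightarrow> real" and s
    using has_sum_reindex_bij_betw[OF bij_prod_decode, of t s] that has_sum_imp_sums by blast
  have "M summable_on UNIV"
    using summable_on_cmult_right[OF summable_on_geometric2, of "2 * C / r"]
    by (simp add: M_def case_prod_unfold)
  hence M: "summable (\<lambda>n. M (prod_decode n))"
    using sums by (auto simp: summable_on_def sums_iff)
  have f_deriv: "(f m has_derivative (\<lambda>h. gx m q * h $ 1 + gy m q * h $ 2)) (at q within S)" for m q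
  proof -
    have lin: "((\<lambda>q. q $ k) has_derivative (\<lambda>h. h $ k)) (at q within S)" for k
      by (intro bounded_linear_imp_has_derivative bounded_linear_vec_nth)
    obtain i j where m: "m = (i, j)" by (cases m)
    show ?thesis unfolding f_def gx_def gy_def m
      by (auto intro!: derivative_eq_intros lin simp: algebra_simps)
  qed
  have gx_le: "norm (gx m q) \<le> M m" if "q \<in> S" for m q
  proof -
    obtain i j where m: "m = (i, j)" by (cases m)
    show ?thesis
    proof (cases i)
      case 0
      thus ?thesis using C r by (simp add: gx_def M_def m)
    next
      case (Suc i')
      thus ?thesis using that cauchy_bound_halved[OF cauchy_bound_deriv_x[OF b], of "q $ 1" "q $ 2" i' j]
        by (simp add: gx_def M_def m S_iff coeff2_deriv_x abs_mult power_abs mult_ac)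
    qed
  qed
  have gy_le: "norm (gy m q) \<le> M m" if "q \<in> S" for m q
  proof -
    obtain i j where m: "m = (i, j)" by (cases m)
    show ?thesis
    proof (cases j)
      case 0
      thus ?thesis using C r by (simp add: gy_def M_def m)
    next
      case (Suc j')
      thus ?thesis using that cauchy_bound_halved[OF cauchy_bound_deriv_y[OF b], of "q $ 1" "q $ 2" i j']
        by (simp add: gy_def M_def m S_iff coeff2_deriv_y abs_mult power_abs mult_ac)
    qed
  qed
  have sx: "(\<lambda>n. gx (prod_decode n) q) sums eval2 (deriv_x F) q"
    and sy: "(\<lambda>n. gy (prod_decode n) q) sums eval2 (fps_deriv F) q" if "q \<in> S" for q
    using that sums[OF eval2_termwise_deriv_x[OF b, of q]] sums[OF eval2_termwise_deriv_y[OF b, of q]]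
    by (simp_all add: S_iff gx_def gy_def case_prod_unfold)
  have ux: "uniform_limit S (\<lambda>n q. \<Sum>i<n. gx (prod_decode i) q) (\<lambda>q. \<Sum>i. gx (prod_decode i) q) sequentially"
    and uy: "uniform_limit S (\<lambda>n q. \<Sum>i<n. gy (prod_decode i) q) (\<lambda>q. \<Sum>i. gy (prod_decode i) q) sequentially"
    by (intro Weierstrass_m_test[OF _ M] gx_le gy_le; assumption)+
  have "\<exists>g. \<forall>q\<in>S. (\<lambda>n. f (prod_decode n) q) sums g q \<and>
      (g has_derivative (\<lambda>h. eval2 (deriv_x F) q * h $ 1 + eval2 (fps_deriv F) q * h $ 2)) (at q within S)"
  proof (rule has_derivative_series[where f' = "\<lambda>n q h. gx (prod_decode n) q * h $ 1 + gy (prod_decode n) q * h $ 2"])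
    show "(f (prod_decode n) has_derivative (\<lambda>h. gx (prod_decode n) q * h $ 1 + gy (prod_decode n) q * h $ 2))
      (at q within S)" for n q by (rule f_deriv)
    show "convex S" by (simp add: S_def convex_box)
    show "p \<in> S" by (rule pS)
    show "(\<lambda>n. f (prod_decode n) p) sums eval2 F p"
      using p r by (intro sums) (auto simp: f_def case_prod_unfold intro!: eval2_has_sum[OF b, unfolded case_prod_unfold])
  next
    fix e :: real assume "e > 0"
    hence "\<forall>\<^sub>F n in sequentially. \<forall>q\<in>S. dist (\<Sum>i<n. gx (prod_decode i) q) (\<Sum>i. gx (prod_decode i) q) < e / 2"
      "\<forall>\<^sub>F n in sequentially. \<forall>q\<in>S. dist (\<Sum>i<n. gy (prod_decode i) q) (\<Sum>i. gy (prod_decode i) q) < e / 2"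
      using uniform_limitD[OF ux, of "e / 2"] uniform_limitD[OF uy, of "e / 2"] by simp_all
    thus "\<forall>\<^sub>F n in sequentially. \<forall>q\<in>S. \<forall>h :: real^2. norm ((\<Sum>i<n. gx (prod_decode i) q * h $ 1 + gy (prod_decode i) q * h $ 2)
        - (eval2 (deriv_x F) q * h $ 1 + eval2 (fps_deriv F) q * h $ 2)) \<le> e * norm h"
    proof eventually_elim
      case (elim n)
      show ?case
      proof (intro ballI allI)
        fix q and h :: "real^2" assume q: "q \<in> S"
        define dx dy where "dx = (\<Sum>i<n. gx (prod_decode i) q) - eval2 (deriv_x F) q"
          and "dy = (\<Sum>i<n. gy (prod_decode i) q) - eval2 (fps_deriv F) q"
        have d: "\<bar>dx\<bar> \<le> e / 2" "\<bar>dy\<bar> \<le> e / 2"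
          using elim q sx[OF q] sy[OF q] by (auto simp: dx_def dy_def dist_real_def sums_iff less_imp_le)
        have "(\<Sum>i<n. gx (prod_decode i) q * h $ 1 + gy (prod_decode i) q * h $ 2)
            - (eval2 (deriv_x F) q * h $ 1 + eval2 (fps_deriv F) q * h $ 2) = dx * h $ 1 + dy * h $ 2"
          by (simp add: dx_def dy_def sum.distrib sum_distrib_right[symmetric] left_diff_distrib)
        also have "norm \<dots> \<le> \<bar>dx\<bar> * \<bar>h $ 1\<bar> + \<bar>dy\<bar> * \<bar>h $ 2\<bar>"
          by (simp add: abs_mult[symmetric] abs_triangle_ineq)
        also have "\<dots> \<le> e / 2 * norm h + e / 2 * norm h"
          using d \<open>e > 0\<close> by (intro add_mono mult_mono component_le_norm_cart) auto
        finally show "norm ((\<Sum>i<n. gx (prod_decode i) q * h $ 1 + gy (prod_decode i) q * h $ 2)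
            - (eval2 (deriv_x F) q * h $ 1 + eval2 (fps_deriv F) q * h $ 2)) \<le> e * norm h" by simp
      qed
    qed
  qed
  then obtain g where g: "\<And>q. q \<in> S \<Longrightarrow> (\<lambda>n. f (prod_decode n) q) sums g q"
    "\<And>q. q \<in> S \<Longrightarrow> (g has_derivative (\<lambda>h. eval2 (deriv_x F) q * h $ 1 + eval2 (fps_deriv F) q * h $ 2)) (at q within S)"
    by blast
  have "open S" by (simp add: S_def open_box)
  have "g q = eval2 F q" if "q \<in> S" for q
  proof -
    have "(\<lambda>n. f (prod_decode n) q) sums eval2 F q"
      using that r by (intro sums) (auto simp: f_def case_prod_unfold S_iff intro!: eval2_has_sum[OF b, unfolded case_prod_unfold])
    thus ?thesis using g(1)[OF that] sums_unique2 by blast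
  qed
  hence eq: "\<And>q. q \<in> S \<Longrightarrow> g q = eval2 F q" by blast
  have "(g has_derivative (\<lambda>h. eval2 (deriv_x F) p * h $ 1 + eval2 (fps_deriv F) p * h $ 2)) (at p)"
    using g(2)[OF pS] at_within_open[OF pS \<open>open S\<close>] by simp
  thus ?thesis by (rule has_derivative_transform_within_open[OF _ \<open>open S\<close> pS eq])
qed

lemma partial_eq_of_has_derivative:
  assumes "(f has_derivative D) (at p)"
  shows "partial i f p = D (axis i 1)"
proof -
  have "((\<lambda>t. p + t *\<^sub>R axis i 1) has_derivative (\<lambda>t. t *\<^sub>R axis i 1)) (at 0)"
    by (auto intro!: derivative_eq_intros)
  moreover have "(f has_derivative D) (at (p + 0 *\<^sub>R axis i 1))" using assms by simp
  ultimately have "(f \<circ> (\<lambda>t. p + t *\<^sub>R axis i 1) has_derivative D \<circ> (\<lambda>t. t *\<^sub>R axis i 1)) (at 0)"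
    by (rule diff_chain_at)
  moreover have "D \<circ> (\<lambda>t. t *\<^sub>R axis i 1) = (*) (D (axis i 1))"
    using has_derivative_linear[OF assms] by (auto simp: linear_cmul fun_eq_iff)
  ultimately have "((\<lambda>t. f (p + t *\<^sub>R axis i 1)) has_field_derivative D (axis i 1)) (at 0)"
    by (simp add: has_field_derivative_def o_def)
  thus ?thesis unfolding partial_def by (rule DERIV_imp_deriv)
qed

text \<open>An analytic germ agrees with the sum of its series in a neighbourhood of every point close
  to the origin, so it inherits the derivative there and not only at the origin itself.\<close>

lemma has_taylor2_eventually_has_derivative:
  assumes "has_taylor2 f F"
  shows "\<forall>\<^sub>F p in nhds 0. (f has_derivative (\<lambda>h. eval2 (deriv_x F) p * h $ 1 + eval2 (fps_deriv F) p * h $ 2)) (at p)"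
proof -
  obtain C r where b: "cauchy_bound F C r" using has_taylor2_imp_cauchy_bound[OF assms] by blast
  hence "\<forall>\<^sub>F p in nhds (0 :: real^2). \<bar>p $ 1\<bar> < r / 4 \<and> \<bar>p $ 2\<bar> < r / 4"
    by (auto simp: eventually_nhds_0_square cauchy_bound_def intro!: exI[of _ "r / 4"])
  moreover have "\<forall>\<^sub>F p in nhds 0. \<forall>\<^sub>F q in nhds p. f q = eval2 F q"
    unfolding eventually_eventually by (rule has_taylor2_eventually_eval2[OF assms])
  ultimately show ?thesis
  proof eventually_elim
    case (elim p)
    hence "f p = eval2 F p" by (blast dest: eventually_nhds_x_imp_x)
    moreover from elim have "\<forall>\<^sub>F q in at p. eval2 F q = f q"
      unfolding eventually_at_filter by (auto elim: eventually_mono)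
    ultimately show ?case using eval2_has_derivative[OF b] elim
      by (blast intro: has_derivative_transform_eventually[OF eval2_has_derivative[OF b]] sym)
  qed
qed

lemma has_taylor2_eventually_partial:
  assumes "has_taylor2 f F"
  shows "\<forall>\<^sub>F p in nhds 0. eval2 (deriv_x F) p = partial 1 f p"
    and "\<forall>\<^sub>F p in nhds 0. eval2 (fps_deriv F) p = partial 2 f p"
  using has_taylor2_eventually_has_derivative[OF assms]
  by (eventually_elim, simp add: partial_eq_of_has_derivative axis_def)+

text \<open>Partial derivatives of analytic germs are analytic, so the preceding results apply to them
  again. This is what makes the entries of the Jacobian matrix differentiable.\<close>

lemma has_taylor2_partial_1:
  assumes "has_taylor2 f F" shows "has_taylor2 (partial 1 f) (deriv_x F)"
  using has_taylor2_cong[OF has_taylor2_eventually_partial(1)[OF assms]]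
    has_taylor2_imp_cauchy_bound[OF assms] cauchy_bound_deriv_x has_taylor2_eval2 by blast

lemma has_taylor2_partial_2:
  assumes "has_taylor2 f F" shows "has_taylor2 (partial 2 f) (fps_deriv F)"
  using has_taylor2_cong[OF has_taylor2_eventually_partial(2)[OF assms]]
    has_taylor2_imp_cauchy_bound[OF assms] cauchy_bound_deriv_y has_taylor2_eval2 by blast

lemma has_taylor2_eventually_has_derivative_partial:
  assumes "has_taylor2 f F"
  shows "\<forall>\<^sub>F p in nhds 0. (f has_derivative (\<lambda>h. partial 1 f p * h $ 1 + partial 2 f p * h $ 2)) (at p)"
  using has_taylor2_eventually_has_derivative[OF assms] has_taylor2_eventually_partial[OF assms]
  by eventually_elim simp

section \<open>Values on the axis and at the origin\<close>

lemma vector_0_0: "vector [0, 0] = (0 :: real^2)"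
  by (simp add: vec_eq_iff forall_2)

lemma eventually_nhds_axis:
  assumes "\<forall>\<^sub>F p in nhds (0 :: real^2). P p"
  shows "\<forall>\<^sub>F x in nhds 0. P (vector [x, 0])"
proof -
  obtain r where r: "r > 0" "\<And>p. \<bar>p $ 1\<bar> < r \<Longrightarrow> \<bar>p $ 2\<bar> < r \<Longrightarrow> P p"
    using assms by (auto simp: eventually_nhds_0_square)
  thus ?thesis by (auto simp: eventually_nhds_metric intro!: exI[of _ r])
qed

text \<open>Setting \<open>y = 0\<close> in \<open>\<real>[[x]][[y]]\<close> is taking the coefficient of \<open>y\<^sup>0\<close>.\<close>

lemma has_taylor2_axis:
  assumes "has_taylor2 f F"
  shows "(\<lambda>x. f (vector [x, 0])) has_fps_expansion fps_nth F 0"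
proof -
  from assms obtain r where r: "r > 0" and F: "\<And>p. \<bar>p $ 1\<bar> < r \<Longrightarrow> \<bar>p $ 2\<bar> < r \<Longrightarrow>
     ((\<lambda>(i, j). coeff2 F i j * (p $ 1) ^ i * (p $ 2) ^ j) has_sum f p) UNIV"
    by (auto simp: has_taylor2_def)
  have s: "((\<lambda>i. fps_nth (fps_nth F 0) i * x ^ i) has_sum f (vector [x, 0])) UNIV" if "\<bar>x\<bar> < r" for x
  proof -
    let ?g = "\<lambda>(i, j). coeff2 F i j * x ^ i * 0 ^ j"
    have "(?g has_sum f (vector [x, 0])) UNIV" using F[of "vector [x, 0]"] that r by simp
    moreover have "(?g has_sum s) (range (\<lambda>i. (i, 0))) \<longleftrightarrow> (?g has_sum s) UNIV" for s
      by (rule has_sum_cong_neutral) (auto simp: image_iff power_0_left)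
    ultimately have "(?g has_sum f (vector [x, 0])) (range (\<lambda>i. (i, 0)))" by simp
    hence "((?g \<circ> (\<lambda>i. (i, 0))) has_sum f (vector [x, 0])) UNIV"
      by (subst (asm) has_sum_reindex) (auto intro!: injI)
    thus ?thesis by (simp add: o_def coeff2_def)
  qed
  show ?thesis unfolding has_fps_expansion_def
  proof
    have "summable (\<lambda>n. fps_nth (fps_nth F 0) n * (r / 2) ^ n)"
      using has_sum_imp_sums[OF s[of "r / 2"]] r by (auto simp: sums_iff)
    hence "ereal (norm (r / 2)) \<le> fps_conv_radius (fps_nth F 0)"
      unfolding fps_conv_radius_def by (rule conv_radius_geI)
    moreover have "0 < ereal (norm (r / 2))" using r by simp
    ultimately show "fps_conv_radius (fps_nth F 0) > 0" by (rule order_less_le_trans[rotated])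
    have "\<forall>\<^sub>F x in nhds 0. x \<in> ball 0 r" using r by (intro eventually_nhds_in_open) auto
    thus "\<forall>\<^sub>F x in nhds 0. eval_fps (fps_nth F 0) x = f (vector [x, 0])"
    proof eventually_elim
      case (elim x)
      thus ?case using has_sum_imp_sums[OF s[of x]] by (simp add: eval_fps_def sums_iff)
    qed
  qed
qed

lemma has_taylor2_at_0:
  assumes "has_taylor2 f F" shows "f 0 = coeff2 F 0 0"
  using has_taylor2_axis[OF assms]
  by (auto simp: has_fps_expansion_def vector_0_0 coeff2_def eval_fps_at_0 dest: eventually_nhds_x_imp_x)

lemma has_taylor2_has_derivative_at_0:
  assumes "has_taylor2 f F"
  shows "(f has_derivative (\<lambda>h. coeff2 F 1 0 * h $ 1 + coeff2 F 0 1 * h $ 2)) (at 0)"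
  using eventually_nhds_x_imp_x[OF has_taylor2_eventually_has_derivative_partial[OF assms]]
    has_taylor2_at_0[OF has_taylor2_partial_1[OF assms]]
    has_taylor2_at_0[OF has_taylor2_partial_2[OF assms]]
  by (simp add: coeff2_deriv_x coeff2_deriv_y)

lemma has_taylor2_times_y:
  assumes "has_taylor2 g H"
  shows "has_taylor2 (\<lambda>p. p $ 2 * g p) (fps_X * H)"
proof -
  have c: "coeff2 (fps_X * H) i j = (if j = 0 then 0 else coeff2 H i (j - 1))" for i j
    by (simp add: coeff2_def)
  from assms obtain r where r: "r > 0" and H: "\<And>p. \<bar>p $ 1\<bar> < r \<Longrightarrow> \<bar>p $ 2\<bar> < r \<Longrightarrow>
     ((\<lambda>(i, j). coeff2 H i j * (p $ 1) ^ i * (p $ 2) ^ j) has_sum g p) UNIV"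
    by (auto simp: has_taylor2_def)
  have "((\<lambda>(i, j). coeff2 (fps_X * H) i j * (p $ 1) ^ i * (p $ 2) ^ j) has_sum p $ 2 * g p) UNIV"
    (is "(?g has_sum _) _") if p: "\<bar>p $ 1\<bar> < r" "\<bar>p $ 2\<bar> < r" for p
  proof -
    have "((?g \<circ> map_prod id Suc) has_sum p $ 2 * g p) UNIV"
      using has_sum_cmult_right[OF H[OF p], of "p $ 2"]
      by (simp add: o_def case_prod_unfold c mult_ac)
    hence "(?g has_sum p $ 2 * g p) (range (map_prod id Suc))"
      by (subst has_sum_reindex) (auto intro!: injI)
    moreover have *: "?g q = 0" if "q \<notin> range (map_prod id Suc)" for q :: "nat \<times> nat"
    proof (cases q)
      case (Pair i j)
      show ?thesis
      proof (cases j)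
        case (Suc j')
        hence "q = map_prod id Suc (i, j')" using Pair by simp
        with that show ?thesis by blast
      qed (use Pair in \<open>simp add: c\<close>)
    qed
    have "(?g has_sum s) UNIV \<longleftrightarrow> (?g has_sum s) (range (map_prod id Suc))" for s
      by (rule has_sum_cong_neutral) (use * in auto)
    ultimately show ?thesis by simp
  qed
  thus ?thesis using r by (auto simp: has_taylor2_def)
qed

section \<open>Derivatives and Jacobian matrices in the plane\<close>

lemma taylor2_eq: "has_taylor2 f F \<Longrightarrow> taylor2 f = F"
  unfolding taylor2_def by (blast intro: the_equality has_taylor2_unique)

lemma ord_at_0_eq: "h has_fps_expansion H \<Longrightarrow> ord_at_0 h = fps_ord H"
  unfolding ord_at_0_def by (subst the_equality) (auto intro: has_fps_expansion_unique_real)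

text \<open>The gradient is the vector representing the derivative through the inner product, namely
  the image of \<open>1\<close> under the adjoint of the derivative.\<close>

lemma dir_deriv_eq_of_has_derivative:
  assumes "(h has_derivative D) (at p)"
  shows "dir_deriv q h p = D q"
proof -
  have D: "linear D" using assms by (rule has_derivative_linear)
  have eq: "x \<bullet> adjoint D 1 = D x" for x using adjoint_works[OF D, of x 1] by simp
  have "gradient h p = adjoint D 1" unfolding gradient_def
  proof (rule the_equality)
    show "GDERIV h p :> adjoint D 1" unfolding gderiv_def using assms by (simp add: eq)
    fix v assume "GDERIV h p :> v"
    hence "(\<lambda>x. x \<bullet> v) = D" unfolding gderiv_def using assms by (rule has_derivative_unique)
    hence "x \<bullet> v = x \<bullet> adjoint D 1" for x by (simp add: eq fun_eq_iff)
    thus "v = adjoint D 1" using vector_eq_ldot[of v "adjoint D 1"] by blast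
  qed
  thus ?thesis by (simp add: dir_deriv_def eq inner_commute)
qed

lemma jacobian_vector_2:
  fixes \<Phi> \<Psi> :: "real^2 \<Rightarrow> real"
  assumes "(\<Phi> has_derivative (\<lambda>h. a * h $ 1 + b * h $ 2)) (at p)"
    and "(\<Psi> has_derivative (\<lambda>h. c * h $ 1 + d * h $ 2)) (at p)"
  shows "jacobian (\<lambda>p. vector [\<Phi> p, \<Psi> p] :: real^2) (at p) = vector [vector [a, b], vector [c, d]]"
proof -
  have "((\<lambda>p. vector [\<Phi> p, \<Psi> p] :: real^2) has_derivative
      (\<lambda>h. vector [a * h $ 1 + b * h $ 2, c * h $ 1 + d * h $ 2])) (at p)"
    using assms by (subst has_derivative_componentwise_within) (auto simp: Basis_vec_def inner_axis UNIV_2)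
  from frechet_derivative_at[OF this, symmetric] show ?thesis
    by (simp add: jacobian_def matrix_def vec_eq_iff forall_2 axis_def)
qed

text \<open>The diagonal of a power of an upper triangular matrix consists of the powers of its
  diagonal entries.\<close>

lemma nilpotent_upper_triangular_2:
  fixes A :: "real^2^2"
  assumes "nilpotent_matrix A" "A $ 2 $ 1 = 0"
  shows "A $ 1 $ 1 = 0 \<and> A $ 2 $ 2 = 0"
proof -
  have "(((**) A) ^^ k) (mat 1) $ 1 $ 1 = (A $ 1 $ 1) ^ k \<and> (((**) A) ^^ k) (mat 1) $ 2 $ 1 = 0 \<and>
      (((**) A) ^^ k) (mat 1) $ 2 $ 2 = (A $ 2 $ 2) ^ k" for k
    using assms(2) by (induction k) (simp_all add: mat_def matrix_matrix_mult_def sum_2)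
  thus ?thesis using assms(1) unfolding nilpotent_matrix_def by (metis power_eq_0_iff zero_index)
qed

section \<open>Dimension of a subspace relative to a smaller one\<close>

text \<open>A locale extending \<open>vector_space\<close> is used so that the notions defined here are not also
  instantiated for real vector spaces, where they would shadow the generic ones.\<close>

locale codimension = vector_space scale
  for scale :: "'a::field \<Rightarrow> 'b::ab_group_add \<Rightarrow> 'b" (infixr "*\<^sub>s" 75)
begin

text \<open>\<open>rel_dim I n E\<close> expresses \<open>dim (E / I) = n\<close> for subspaces \<open>I \<subseteq> E\<close> without forming the quotient:
  \<open>E\<close> arises from \<open>I\<close> by adjoining \<open>n\<close> vectors, each outside the space reached so far. The
  dimension of an algebra over a subfield is built up by the same two rules.\<close>

inductive rel_dim :: "'b set \<Rightarrow> nat \<Rightarrow> 'b set \<Rightarrow> bool" for I where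
  base: "rel_dim I 0 I"
| adjoin: "rel_dim I n E \<Longrightarrow> v \<notin> E \<Longrightarrow> rel_dim I (Suc n) {e + c *\<^sub>s v | e c. e \<in> E}"

lemma subspace_adjoin:
  assumes "subspace E"
  shows "subspace {e + c *\<^sub>s v | e c. e \<in> E}"
proof (rule subspaceI)
  show "0 \<in> {e + c *\<^sub>s v | e c. e \<in> E}"
    using subspace_0[OF assms] by (force intro: exI[of _ 0])
next
  fix x y assume "x \<in> {e + c *\<^sub>s v | e c. e \<in> E}" "y \<in> {e + c *\<^sub>s v | e c. e \<in> E}"
  then obtain e c e' c' where "e \<in> E" "e' \<in> E" "x = e + c *\<^sub>s v" "y = e' + c' *\<^sub>s v" by blast
  moreover from this have "x + y = (e + e') + (c + c') *\<^sub>s v" by (simp add: scale_left_distrib)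
  ultimately show "x + y \<in> {e + c *\<^sub>s v | e c. e \<in> E}" using subspace_add[OF assms] by blast
next
  fix d x assume "x \<in> {e + c *\<^sub>s v | e c. e \<in> E}"
  then obtain e c where "e \<in> E" "x = e + c *\<^sub>s v" by blast
  moreover from this have "d *\<^sub>s x = d *\<^sub>s e + (d * c) *\<^sub>s v" by (simp add: scale_right_distrib)
  ultimately show "d *\<^sub>s x \<in> {e + c *\<^sub>s v | e c. e \<in> E}" using subspace_scale[OF assms] by blast
qed

lemma adjoin_superset: "E \<subseteq> {e + c *\<^sub>s v | e c. e \<in> E}"
  by (force intro: exI[of _ 0])

lemma adjoin_self:
  assumes "subspace E" shows "v \<in> {e + c *\<^sub>s v | e c. e \<in> E}"
  using subspace_0[OF assms] by (auto intro!: exI[of _ 0] exI[of _ 1])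

lemma rel_dim_subspace:
  assumes "rel_dim I n E" "subspace I"
  shows "subspace E" and "I \<subseteq> E"
proof -
  from assms have "subspace E \<and> I \<subseteq> E"
  proof induction
    case (adjoin n E v)
    thus ?case using subspace_adjoin[of E v] adjoin_superset[of E v] by blast
  qed auto
  thus "subspace E" "I \<subseteq> E" by auto
qed

lemma rel_dim_trans:
  assumes "rel_dim J m K" "rel_dim I n J"
  shows "rel_dim I (n + m) K"
  using assms(1)
proof induction
  case (adjoin m E v)
  thus ?case using rel_dim.adjoin[of I "n + m" E v] by simp
qed (use assms(2) in simp)

lemma adjoin_eq:
  assumes F: "subspace F" and w: "w \<in> F" and E: "E \<subseteq> F"
    and codim: "\<And>x. x \<in> F \<Longrightarrow> \<exists>d. x - d *\<^sub>s w \<in> E"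
  shows "{e + c *\<^sub>s w | e c. e \<in> E} = F"
proof
  show "{e + c *\<^sub>s w | e c. e \<in> E} \<subseteq> F"
    using E by (auto intro!: subspace_add[OF F] subspace_scale[OF F] w)
  show "F \<subseteq> {e + c *\<^sub>s w | e c. e \<in> E}"
  proof
    fix x assume "x \<in> F"
    then obtain d where "x - d *\<^sub>s w \<in> E" using codim by blast
    moreover have "x = (x - d *\<^sub>s w) + d *\<^sub>s w" by simp
    ultimately show "x \<in> {e + c *\<^sub>s w | e c. e \<in> E}" by blast
  qed
qed

text \<open>With preimages taken in \<open>W\<close>, a linear map embeds \<open>T\<^sup>-\<^sup>1(E) / T\<^sup>-\<^sup>1(I)\<close> into \<open>E / I\<close>, so the dimension cannot grow, and it stays the
  same only if every class of \<open>E\<close> is attained. Along a chain from \<open>I\<close> to \<open>E\<close> each step enlarges the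
  preimage by at most one vector. With \<open>T\<close> the identity this bounds the dimension of
  subspaces.\<close>

lemma rel_dim_vimage:
  assumes E: "rel_dim I n E" and I: "subspace I" and W: "subspace W"
    and T: "Vector_Spaces.linear scale scale T"
  shows "\<exists>k\<le>n. rel_dim {x \<in> W. T x \<in> I} k {x \<in> W. T x \<in> E} \<and>
    (I \<subseteq> T ` W \<longrightarrow> k = n \<longrightarrow> E \<subseteq> T ` W)"
  using E
proof induction
  case base
  thus ?case by (auto intro: rel_dim.base)
next
  case (adjoin n E v)
  interpret T: Vector_Spaces.linear scale scale T by fact
  define E' where "E' = {e + c *\<^sub>s v | e c. e \<in> E}"
  have E: "subspace E" and E': "subspace E'" "E \<subseteq> E'"
    using rel_dim_subspace[OF adjoin(1) I] subspace_adjoin adjoin_superset by (auto simp: E'_def)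
  from adjoin.IH obtain k where k: "k \<le> n" "rel_dim {x \<in> W. T x \<in> I} k {x \<in> W. T x \<in> E}"
    "I \<subseteq> T ` W \<Longrightarrow> k = n \<Longrightarrow> E \<subseteq> T ` W" by blast
  have TW: "subspace (T ` W)" using W by (rule T.subspace_image)
  show ?case unfolding E'_def[symmetric]
  proof (cases "{x \<in> W. T x \<in> E'} \<subseteq> {x \<in> W. T x \<in> E}")
    case True
    hence "{x \<in> W. T x \<in> E'} = {x \<in> W. T x \<in> E}" using E'(2) by blast
    thus "\<exists>k\<le>Suc n. rel_dim {x \<in> W. T x \<in> I} k {x \<in> W. T x \<in> E'} \<and>
      (I \<subseteq> T ` W \<longrightarrow> k = Suc n \<longrightarrow> E' \<subseteq> T ` W)"
      using k by (intro exI[of _ k]) auto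
  next
    case False
    then obtain w where w: "w \<in> W" "T w \<in> E'" "T w \<notin> E" by blast
    then obtain e c where e: "e \<in> E" "T w = e + c *\<^sub>s v" by (auto simp: E'_def)
    have c: "c \<noteq> 0" using w e by auto
    have v: "v = inverse c *\<^sub>s (T w - e)" using c e(2) by simp
    \<comment> \<open>Since \<open>c \<noteq> 0\<close>, the vector \<open>T w\<close> can replace \<open>v\<close> as the one adjoined to \<open>E\<close>.\<close>
    have codim: "\<exists>d. x - d *\<^sub>s T w \<in> E" if "x \<in> E'" for x
    proof -
      from that obtain e' c' where x: "e' \<in> E" "x = e' + c' *\<^sub>s v" by (auto simp: E'_def)
      have "x - (c' * inverse c) *\<^sub>s T w = e' - (c' * inverse c) *\<^sub>s e"
        unfolding x(2) by (subst v) (simp add: scale_right_diff_distrib)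
      thus ?thesis using subspace_diff[OF E x(1) subspace_scale[OF E e(1)]] by metis
    qed
    have "{e + c *\<^sub>s w | e c. e \<in> {x \<in> W. T x \<in> E}} = {x \<in> W. T x \<in> E'}"
    proof (rule adjoin_eq)
      have "{x \<in> W. T x \<in> E'} = W \<inter> T -` E'" by auto
      thus "subspace {x \<in> W. T x \<in> E'}"
        using W T.subspace_vimage[OF E'(1)] by (simp add: subspace_inter)
      show "w \<in> {x \<in> W. T x \<in> E'}" using w by simp
      show "{x \<in> W. T x \<in> E} \<subseteq> {x \<in> W. T x \<in> E'}" using E'(2) by blast
      fix x assume x: "x \<in> {x \<in> W. T x \<in> E'}"
      then obtain d where "T x - d *\<^sub>s T w \<in> E" using codim by blast
      moreover have "x - d *\<^sub>s w \<in> W" using x w W by (simp add: subspace_diff subspace_scale)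
      ultimately show "\<exists>d. x - d *\<^sub>s w \<in> {x \<in> W. T x \<in> E}"
        by (intro exI[of _ d]) (simp add: T.diff T.scale)
    qed
    hence "rel_dim {x \<in> W. T x \<in> I} (Suc k) {x \<in> W. T x \<in> E'}"
      using rel_dim.adjoin[OF k(2), of w] w by simp
    moreover have "E' \<subseteq> T ` W" if "I \<subseteq> T ` W" "Suc k = Suc n"
    proof
      fix x assume "x \<in> E'"
      then obtain d where "x - d *\<^sub>s T w \<in> E" using codim by blast
      hence "x - d *\<^sub>s T w \<in> T ` W" using k(3) that by auto
      moreover have "d *\<^sub>s T w \<in> T ` W" using subspace_scale[OF TW] w by blast
      ultimately have "(x - d *\<^sub>s T w) + d *\<^sub>s T w \<in> T ` W" by (rule subspace_add[OF TW])
      thus "x \<in> T ` W" by simp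
    qed
    ultimately show "\<exists>k\<le>Suc n. rel_dim {x \<in> W. T x \<in> I} k {x \<in> W. T x \<in> E'} \<and>
      (I \<subseteq> T ` W \<longrightarrow> k = Suc n \<longrightarrow> E' \<subseteq> T ` W)"
      using k(1) by (intro exI[of _ "Suc k"]) auto
  qed
qed

text \<open>A chain of length \<open>m\<close> ends with a proper subspace \<open>F\<close> of codimension one. By
  \<open>rel_dim_vimage\<close> a chain of length \<open>n\<close> up to \<open>E\<close> restricts to a strictly shorter one up to \<open>F\<close>,
  and induction applies.\<close>

lemma rel_dim_unique:
  assumes "subspace I" "rel_dim I n E" "rel_dim I m E"
  shows "n = m"
proof -
  have le: "m \<le> n" if "rel_dim I n E" "rel_dim I m E" for n m E
    using that
  proof (induction n arbitrary: E m rule: less_induct)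
    case (less n)
    show ?case
    proof (cases m)
      case (Suc m')
      from less.prems(2) obtain F v where F: "rel_dim I m' F" "v \<notin> F" "E = {e + c *\<^sub>s v | e c. e \<in> F}"
        unfolding Suc by cases auto
      have sub: "subspace F" "I \<subseteq> F" using rel_dim_subspace[OF F(1) assms(1)] by auto
      have "v \<in> E" unfolding F(3) by (rule adjoin_self[OF sub(1)])
      hence neq: "\<not> E \<subseteq> F" using F(2) by blast
      from rel_dim_vimage[OF less.prems(1) assms(1) sub(1) linear_id]
      obtain k where k: "k \<le> n" "rel_dim {x \<in> F. x \<in> I} k {x \<in> F. x \<in> E}" "k \<noteq> n"
        using sub neq by auto
      have "{x \<in> F. x \<in> I} = I" "{x \<in> F. x \<in> E} = F"
        using sub adjoin_superset[of F v] by (auto simp: F(3))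
      with k have "rel_dim I k F" "k < n" by auto
      thus ?thesis using less.IH[OF _ _ F(1), of k] Suc by simp
    qed simp
  qed
  show ?thesis using le[OF assms(2,3)] le[OF assms(3,2)] by simp
qed

text \<open>\<open>T\<close> induces an isomorphism from \<open>E / T\<^sup>-\<^sup>1(I)\<close> onto \<open>(I + T E) / I\<close>.\<close>

lemma rel_dim_image:
  assumes "rel_dim {x \<in> W. T x \<in> I} k E" "E \<subseteq> W"
    and I: "subspace I" and W: "subspace W" and T: "Vector_Spaces.linear scale scale T"
  shows "rel_dim I k {i + T x | i x. i \<in> I \<and> x \<in> E}"
  using assms(1,2)
proof induction
  interpret T: Vector_Spaces.linear scale scale T by fact
  case base
  have "{i + T x | i x. i \<in> I \<and> x \<in> {x \<in> W. T x \<in> I}} = I"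
  proof
    show "I \<subseteq> {i + T x | i x. i \<in> I \<and> x \<in> {x \<in> W. T x \<in> I}}"
      using subspace_0[OF W] subspace_0[OF I] T.zero by (force intro: exI[of _ 0])
  qed (auto intro: subspace_add[OF I])
  thus ?case by (simp add: rel_dim.base)
next
  interpret T: Vector_Spaces.linear scale scale T by fact
  case (adjoin k E v)
  have pre: "subspace {x \<in> W. T x \<in> I}"
  proof -
    have "{x \<in> W. T x \<in> I} = W \<inter> T -` I" by auto
    thus ?thesis using W T.subspace_vimage[OF I] by (simp add: subspace_inter)
  qed
  have E: "subspace E" "{x \<in> W. T x \<in> I} \<subseteq> E" using rel_dim_subspace[OF adjoin(1) pre] by auto
  have EW: "E \<subseteq> W" using adjoin(4) adjoin_superset[of E v] by blast
  have v: "v \<in> W" using adjoin(4) adjoin_self[OF E(1), of v] by blast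
  have "T v \<notin> {i + T x | i x. i \<in> I \<and> x \<in> E}"
  proof
    assume "T v \<in> {i + T x | i x. i \<in> I \<and> x \<in> E}"
    then obtain i x where ix: "i \<in> I" "x \<in> E" "T v = i + T x" by blast
    hence "T (v - x) \<in> I" by (simp add: T.diff)
    hence "v - x \<in> E" using v ix EW subspace_diff[OF W] E(2) by blast
    from subspace_add[OF E(1) this ix(2)] show False using adjoin(2) by simp
  qed
  from rel_dim.adjoin[OF adjoin.IH[OF EW] this]
  have "rel_dim I (Suc k) {e + c *\<^sub>s T v | e c. e \<in> {i + T x | i x. i \<in> I \<and> x \<in> E}}" .
  also have "{e + c *\<^sub>s T v | e c. e \<in> {i + T x | i x. i \<in> I \<and> x \<in> E}}
      = {i + T x | i x. i \<in> I \<and> x \<in> {e + c *\<^sub>s v | e c. e \<in> E}}" (is "?L = ?R")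
  proof
    show "?L \<subseteq> ?R"
    proof
      fix z assume "z \<in> ?L"
      then obtain i x c where "i \<in> I" "x \<in> E" "z = i + T x + c *\<^sub>s T v" by blast
      moreover from this have "z = i + T (x + c *\<^sub>s v)" by (simp add: T.add T.scale)
      ultimately show "z \<in> ?R" by blast
    qed
    show "?R \<subseteq> ?L"
    proof
      fix z assume "z \<in> ?R"
      then obtain i x c where "i \<in> I" "x \<in> E" "z = i + T (x + c *\<^sub>s v)" by blast
      moreover from this have "z = (i + T x) + c *\<^sub>s T v" by (simp add: T.add T.scale)
      ultimately show "z \<in> ?L" by blast
    qed
  qed
  finally show ?case .
qed

end

section \<open>Arithmetic of convergent double series\<close>

definition const2 :: "'a::comm_ring_1 \<Rightarrow> 'a fps fps" where
  "const2 c = fps_const (fps_const c)"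

interpretation series: codimension "\<lambda>c :: complex. (*) (const2 c)"
proof -
  have "const2 (a + b) = const2 a + const2 b" "const2 (a * b) = const2 a * const2 b" "const2 (1 :: complex) = 1"
    for a b :: complex by (simp_all add: const2_def)
  thus "codimension (\<lambda>c :: complex. (*) (const2 c))"
    by (intro codimension.intro) (unfold_locales, simp_all add: algebra_simps)
qed

lemma linear_times: "Vector_Spaces.linear (\<lambda>c :: complex. (*) (const2 c)) (\<lambda>c. (*) (const2 c)) ((*) F)"
  by (intro Vector_Spaces.linear.intro module_hom.intro module_hom_axioms.intro series.vector_space_axioms
      series.module_axioms) (simp_all add: algebra_simps)

lemma coeff2_simps [simp]:
  "coeff2 0 i j = 0" "coeff2 1 i j = (if i = 0 \<and> j = 0 then 1 else 0)"
  "coeff2 (F + H) i j = coeff2 F i j + coeff2 H i j"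
  "coeff2 (F - H) i j = coeff2 F i j - coeff2 H i j"
  "coeff2 (fps_const p) i j = (if j = 0 then fps_nth p i else 0)"
  "coeff2 (const2 c) i j = (if i = 0 \<and> j = 0 then c else 0)"
  "coeff2 (fps_X * F) i j = (if j = 0 then 0 else coeff2 F i (j - 1))"
  for F H :: "'a::comm_ring_1 fps fps"
  by (simp_all add: coeff2_def const2_def)

lemma cauchy_bound_shrink:
  assumes "cauchy_bound F C r" "0 < s" "s \<le> r" shows "cauchy_bound F C s"
proof -
  have "norm (coeff2 F i j) * s ^ i * s ^ j \<le> norm (coeff2 F i j) * r ^ i * r ^ j" for i j
    using assms by (intro mult_mono power_mono) auto
  thus ?thesis using assms unfolding cauchy_bound_def by (blast intro: order_trans)
qed

lemma cauchy_bounds_common: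
  assumes "cauchy_bound F C r" "cauchy_bound H D s"
  shows "\<exists>t. cauchy_bound F C t \<and> cauchy_bound H D t"
proof (intro exI conjI)
  have "0 < r" "0 < s" using assms by (auto simp: cauchy_bound_def)
  thus "cauchy_bound F C (min r s)" "cauchy_bound H D (min r s)"
    using cauchy_bound_shrink[OF assms(1)] cauchy_bound_shrink[OF assms(2)] by auto
qed

lemma cauchy_bound_add:
  assumes "cauchy_bound F C r" "cauchy_bound H D r"
  shows "cauchy_bound (F + H :: complex fps fps) (C + D) r"
proof -
  have r: "r > 0" using assms by (simp add: cauchy_bound_def)
  have "norm (coeff2 (F + H) i j) * r ^ i * r ^ j \<le> C + D" for i j
  proof -
    have "norm (coeff2 (F + H) i j) * r ^ i * r ^ j \<le> (norm (coeff2 F i j) + norm (coeff2 H i j)) * r ^ i * r ^ j"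
      using r by (intro mult_right_mono) (auto simp: norm_triangle_ineq)
    also have "\<dots> = norm (coeff2 F i j) * r ^ i * r ^ j + norm (coeff2 H i j) * r ^ i * r ^ j"
      by (simp add: algebra_simps)
    also have "\<dots> \<le> C + D" using assms by (intro add_mono) (auto simp: cauchy_bound_def)
    finally show ?thesis .
  qed
  thus ?thesis using r by (simp add: cauchy_bound_def)
qed

lemma coeff2_times:
  "coeff2 (F * H) i j = (\<Sum>b=0..j. \<Sum>a=0..i. coeff2 F a b * coeff2 H (i - a) (j - b))"
  by (simp add: coeff2_def fps_mult_nth fps_sum_nth)

text \<open>The coefficient at \<open>(i, j)\<close> of a product has \<open>(i + 1) (j + 1)\<close> summands, each bounded by
  \<open>C D / r\<^sup>i\<^sup>+\<^sup>j\<close>; halving the radius absorbs their number.\<close>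

lemma cauchy_bound_times:
  assumes "cauchy_bound F C r" "cauchy_bound H D r"
  shows "cauchy_bound (F * H :: complex fps fps) (C * D) (r / 2)"
proof -
  have r: "r > 0" and F: "norm (coeff2 F i j) * r ^ i * r ^ j \<le> C"
    and H: "norm (coeff2 H i j) * r ^ i * r ^ j \<le> D" for i j
    using assms by (auto simp: cauchy_bound_def)
  have C: "0 \<le> C" using order_trans[OF norm_ge_zero, of "coeff2 F 0 0" C] F[of 0 0] by simp
  have D: "0 \<le> D" using order_trans[OF norm_ge_zero, of "coeff2 H 0 0" D] H[of 0 0] by simp
  have "norm (coeff2 (F * H) i j) * (r / 2) ^ i * (r / 2) ^ j \<le> C * D" for i j
  proof -
    have "norm (coeff2 (F * H) i j) * (r ^ i * r ^ j)
        \<le> (\<Sum>b=0..j. \<Sum>a=0..i. norm (coeff2 F a b * coeff2 H (i - a) (j - b))) * (r ^ i * r ^ j)"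
      unfolding coeff2_times using r
      by (intro mult_right_mono order_trans[OF norm_sum] sum_mono) auto
    also have "\<dots> = (\<Sum>b=0..j. \<Sum>a=0..i. norm (coeff2 F a b * coeff2 H (i - a) (j - b)) * (r ^ i * r ^ j))"
      by (simp add: sum_distrib_right)
    also have "\<dots> \<le> (\<Sum>b=0..j. \<Sum>a=0..i. C * D)"
    proof (intro sum_mono)
      fix a b assume ab: "b \<in> {0..j}" "a \<in> {0..i}"
      have "r ^ i = r ^ a * r ^ (i - a)" "r ^ j = r ^ b * r ^ (j - b)"
        using ab by (simp_all add: power_add[symmetric])
      hence "norm (coeff2 F a b * coeff2 H (i - a) (j - b)) * (r ^ i * r ^ j)
          = (norm (coeff2 F a b) * r ^ a * r ^ b) * (norm (coeff2 H (i - a) (j - b)) * r ^ (i - a) * r ^ (j - b))"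
        by (simp add: norm_mult)
      also have "\<dots> \<le> C * D" using r C by (intro mult_mono F H) auto
      finally show "norm (coeff2 F a b * coeff2 H (i - a) (j - b)) * (r ^ i * r ^ j) \<le> C * D" .
    qed
    also have "\<dots> = real (Suc i) * real (Suc j) * (C * D)" by simp
    finally have *: "norm (coeff2 (F * H) i j) * (r ^ i * r ^ j) \<le> real (Suc i) * real (Suc j) * (C * D)" .
    have "norm (coeff2 (F * H) i j) * (r / 2) ^ i * (r / 2) ^ j
        = norm (coeff2 (F * H) i j) * (r ^ i * r ^ j) * ((1 / 2) ^ i * (1 / 2) ^ j)"
      by (simp add: power_divide)
    also have "\<dots> \<le> real (Suc i) * real (Suc j) * (C * D) * ((1 / 2) ^ i * (1 / 2) ^ j)"
      using * by (intro mult_right_mono) auto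
    also have "\<dots> = (real (Suc i) * (1 / 2) ^ i) * (real (Suc j) * (1 / 2) ^ j) * (C * D)"
      by (simp add: mult_ac)
    also have "\<dots> \<le> 1 * 1 * (C * D)"
      using C D by (intro mult_mono Suc_mult_half_power_le) auto
    finally show ?thesis by simp
  qed
  thus ?thesis using r by (simp add: cauchy_bound_def)
qed

lemma convergent2_add: "convergent2 F \<Longrightarrow> convergent2 H \<Longrightarrow> convergent2 (F + H)"
  unfolding convergent2_iff_cauchy_bound by (metis cauchy_bounds_common cauchy_bound_add)

lemma convergent2_times: "convergent2 F \<Longrightarrow> convergent2 H \<Longrightarrow> convergent2 (F * H)"
  unfolding convergent2_iff_cauchy_bound by (metis cauchy_bounds_common cauchy_bound_times)

lemma convergent2_fps_const:
  assumes "fps_conv_radius p > 0"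
  shows "convergent2 (fps_const p)"
proof -
  obtain r where r: "0 < ereal r" "ereal r < fps_conv_radius p" using ereal_dense2[OF assms] by blast
  hence "summable (\<lambda>n. norm (fps_nth p n * of_real r ^ n))"
    by (intro abs_summable_in_conv_radius) (auto simp: fps_conv_radius_def)
  hence "Bseq (\<lambda>n. norm (fps_nth p n * of_real r ^ n))"
    by (intro convergent_imp_Bseq convergentI[OF summable_LIMSEQ_zero])
  then obtain C where "\<And>n. norm (fps_nth p n) * r ^ n \<le> C" "C > 0"
    using r by (auto simp: Bseq_def norm_mult norm_power)
  hence "cauchy_bound (fps_const p) C r" using r by (auto simp: cauchy_bound_def less_imp_le)
  thus ?thesis unfolding convergent2_iff_cauchy_bound by blast
qed

text \<open>Together with \<open>convergent2_fps_const\<close> this transfers convergence between one and two variables,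
  so that one-variable results on inverses of convergent series become available.\<close>

lemma convergent2_row:
  assumes "convergent2 F" shows "fps_conv_radius (fps_nth F 0) > 0"
proof -
  obtain C r where b: "cauchy_bound F C r" using assms unfolding convergent2_iff_cauchy_bound by blast
  hence r: "r > 0" by (simp add: cauchy_bound_def)
  have "summable (\<lambda>n. fps_nth (fps_nth F 0) n * of_real (r / 2) ^ n)"
  proof (rule summable_comparison_test')
    show "summable (\<lambda>n. C * (1 / 2 :: real) ^ n)" by (intro summable_mult summable_geometric) simp
    show "norm (fps_nth (fps_nth F 0) n * of_real (r / 2) ^ n) \<le> C * (1 / 2) ^ n" if "n \<ge> 0" for n
      using cauchy_bound_halved[OF b, of "r / 2" 0 n 0] r
      by (simp add: coeff2_def norm_mult norm_power)
  qed
  hence "ereal (norm (of_real (r / 2) :: complex)) \<le> fps_conv_radius (fps_nth F 0)"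
    unfolding fps_conv_radius_def by (rule conv_radius_geI)
  moreover have "0 < ereal (norm (of_real (r / 2) :: complex))" using r by simp
  ultimately show ?thesis by (rule order_less_le_trans[rotated])
qed

lemma convergent2_const2 [simp]: "convergent2 (const2 c)"
  unfolding const2_def by (rule convergent2_fps_const) simp

lemma convergent2_0 [simp]: "convergent2 0" and convergent2_1 [simp]: "convergent2 1"
  using convergent2_const2[of 0] convergent2_const2[of 1] by (simp_all add: const2_def)

lemma const2_minus_1: "const2 (- 1) = - 1"
  by (simp add: fps_eq_iff const2_def fps_const_def)

lemma convergent2_minus: "convergent2 F \<Longrightarrow> convergent2 (- F)"
  using convergent2_times[OF convergent2_const2[of "- 1"], of F] by (simp add: const2_minus_1)

lemma convergent2_diff: "convergent2 F \<Longrightarrow> convergent2 H \<Longrightarrow> convergent2 (F - H)"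
  using convergent2_add[of F "- H"] convergent2_minus[of H] by simp

lemma convergent2_shift_y:
  assumes "convergent2 F" shows "convergent2 (fps_shift 1 F)"
proof -
  obtain C r where b: "cauchy_bound F C r" using assms unfolding convergent2_iff_cauchy_bound by blast
  hence r: "r > 0" by (simp add: cauchy_bound_def)
  have "norm (coeff2 (fps_shift 1 F) i j) * r ^ i * r ^ j \<le> C / r" for i j
  proof -
    have "norm (coeff2 F i (Suc j)) * r ^ i * r ^ Suc j \<le> C" using b unfolding cauchy_bound_def by blast
    thus ?thesis using r by (simp add: coeff2_def field_simps)
  qed
  hence "cauchy_bound (fps_shift 1 F) (C / r) r" using r by (simp add: cauchy_bound_def)
  thus ?thesis unfolding convergent2_iff_cauchy_bound by blast
qed

lemma convergent2_y [simp]: "convergent2 fps_X"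
proof -
  have "norm (coeff2 (fps_X :: complex fps fps) i j) * 1 ^ i * 1 ^ j \<le> 1" for i j
    by (simp add: coeff2_def fps_X_def)
  hence "cauchy_bound (fps_X :: complex fps fps) 1 1" by (simp add: cauchy_bound_def)
  thus ?thesis unfolding convergent2_iff_cauchy_bound by blast
qed

section \<open>The ring of convergent series and its two-generated ideals\<close>

lemma carrier_conv_ring: "carrier conv_ring = Collect convergent2"
  and add_conv_ring: "x \<oplus>\<^bsub>conv_ring\<^esub> y = x + y"
  and mult_conv_ring: "x \<otimes>\<^bsub>conv_ring\<^esub> y = x * y"
  and zero_conv_ring: "\<zero>\<^bsub>conv_ring\<^esub> = 0"
  and one_conv_ring: "\<one>\<^bsub>conv_ring\<^esub> = 1"
  by (simp_all add: conv_ring_def)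

lemmas conv_ring_simps = carrier_conv_ring add_conv_ring mult_conv_ring zero_conv_ring one_conv_ring

interpretation conv: cring conv_ring
proof (rule cringI)
  show "abelian_group conv_ring"
  proof (rule abelian_groupI)
    fix x assume "x \<in> carrier conv_ring"
    thus "\<exists>y\<in>carrier conv_ring. y \<oplus>\<^bsub>conv_ring\<^esub> x = \<zero>\<^bsub>conv_ring\<^esub>"
      by (intro bexI[of _ "- x"]) (auto simp: conv_ring_simps convergent2_minus)
  qed (auto simp: conv_ring_simps convergent2_add add_ac)
  show "Group.comm_monoid conv_ring"
    by (rule comm_monoidI) (auto simp: conv_ring_simps convergent2_times mult_ac)
qed (auto simp: conv_ring_simps algebra_simps)

lemma subspace_convergent2: "series.subspace (Collect convergent2)"
  by (rule series.subspaceI) (auto intro: convergent2_add convergent2_times)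

text \<open>The ideal \<open>(f, g)\<close> of the ring of convergent series, with its elements given explicitly.\<close>

definition ideal2 :: "complex fps fps \<Rightarrow> complex fps fps \<Rightarrow> complex fps fps set" where
  "ideal2 f g = {a * f + b * g | a b. convergent2 a \<and> convergent2 b}"

lemma subspace_ideal2: "series.subspace (ideal2 f g)"
proof (rule series.subspaceI)
  show "0 \<in> ideal2 f g" unfolding ideal2_def by (force intro: exI[of _ 0])
next
  fix x y assume "x \<in> ideal2 f g" "y \<in> ideal2 f g"
  then obtain a b a' b' where c: "convergent2 a" "convergent2 b" "convergent2 a'" "convergent2 b'"
    and xy: "x = a * f + b * g" "y = a' * f + b' * g" by (auto simp: ideal2_def)
  have "x + y = (a + a') * f + (b + b') * g" by (simp add: xy algebra_simps)
  thus "x + y \<in> ideal2 f g" using c convergent2_add unfolding ideal2_def by blast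
next
  fix c x assume "x \<in> ideal2 f g"
  then obtain a b where c: "convergent2 a" "convergent2 b" and x: "x = a * f + b * g" by (auto simp: ideal2_def)
  have "const2 c * x = (const2 c * a) * f + (const2 c * b) * g" by (simp add: x algebra_simps)
  thus "const2 c * x \<in> ideal2 f g" using c convergent2_times unfolding ideal2_def by (metis (mono_tags, lifting) convergent2_const2 mem_Collect_eq)
qed

lemma ideal2_times:
  assumes "x \<in> ideal2 f g" "convergent2 r" shows "r * x \<in> ideal2 f g"
proof -
  from assms obtain a b where c: "convergent2 a" "convergent2 b" and x: "x = a * f + b * g" by (auto simp: ideal2_def)
  have "r * x = (r * a) * f + (r * b) * g" by (simp add: x algebra_simps)
  moreover have "convergent2 (r * a)" "convergent2 (r * b)" using c assms convergent2_times by auto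
  ultimately show ?thesis unfolding ideal2_def by blast
qed

lemma ideal2_generators: "f \<in> ideal2 f g" "g \<in> ideal2 f g"
proof -
  have "f = 1 * f + 0 * g" "g = 0 * f + 1 * g" by simp_all
  thus "f \<in> ideal2 f g" "g \<in> ideal2 f g" unfolding ideal2_def
    using convergent2_0 convergent2_1 by blast+
qed

lemma ideal2_convergent2:
  assumes "convergent2 f" "convergent2 g" shows "ideal2 f g \<subseteq> Collect convergent2"
  using assms by (auto simp: ideal2_def intro!: convergent2_add convergent2_times)

lemma ideal_ideal2:
  assumes "convergent2 f" "convergent2 g" shows "ideal (ideal2 f g) conv_ring"
proof (rule idealI)
  show "ring conv_ring" by (rule conv.ring_axioms)
  show "subgroup (ideal2 f g) (add_monoid conv_ring)"
  proof (rule conv.add.subgroupI)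
    show "ideal2 f g \<subseteq> carrier conv_ring" using ideal2_convergent2[OF assms] by (simp add: conv_ring_simps)
    show "ideal2 f g \<noteq> {}" using ideal2_generators by blast
    fix x assume x: "x \<in> ideal2 f g"
    hence "- x \<in> ideal2 f g" by (rule series.subspace_neg[OF subspace_ideal2])
    moreover have "\<ominus>\<^bsub>conv_ring\<^esub> x = - x"
      using x ideal2_convergent2[OF assms] convergent2_minus[of x]
      by (intro conv.minus_equality) (auto simp: conv_ring_simps)
    ultimately show "\<ominus>\<^bsub>conv_ring\<^esub> x \<in> ideal2 f g" by simp
  next
    fix x y assume "x \<in> ideal2 f g" "y \<in> ideal2 f g"
    thus "x \<oplus>\<^bsub>conv_ring\<^esub> y \<in> ideal2 f g"
      using series.subspace_add[OF subspace_ideal2] by (simp add: conv_ring_simps)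
  qed
qed (use ideal2_times in \<open>auto simp: conv_ring_simps mult.commute\<close>)

lemma genideal_eq_ideal2:
  assumes "convergent2 f" "convergent2 g"
  shows "Idl\<^bsub>conv_ring\<^esub> {f, g} = ideal2 f g"
proof
  show "Idl\<^bsub>conv_ring\<^esub> {f, g} \<subseteq> ideal2 f g"
    using ideal_ideal2[OF assms] ideal2_generators by (intro conv.genideal_minimal) auto
  interpret I: ideal "Idl\<^bsub>conv_ring\<^esub> {f, g}" conv_ring
    using assms by (intro conv.genideal_ideal) (auto simp: conv_ring_simps)
  have gen: "f \<in> Idl\<^bsub>conv_ring\<^esub> {f, g}" "g \<in> Idl\<^bsub>conv_ring\<^esub> {f, g}"
    using conv.genideal_self[of "{f, g}"] assms by (auto simp: conv_ring_simps)
  show "ideal2 f g \<subseteq> Idl\<^bsub>conv_ring\<^esub> {f, g}"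
  proof
    fix x assume "x \<in> ideal2 f g"
    then obtain a b where c: "convergent2 a" "convergent2 b" and x: "x = a * f + b * g" by (auto simp: ideal2_def)
    show "x \<in> Idl\<^bsub>conv_ring\<^esub> {f, g}"
      using I.a_closed[OF I.I_l_closed[OF gen(1), of a] I.I_l_closed[OF gen(2), of b]] c
      by (simp add: x conv_ring_simps)
  qed
qed

section \<open>Intersection numbers as relative dimensions\<close>

lemma coset_eq_iff:
  assumes "series.subspace I"
  shows "I +>\<^bsub>conv_ring\<^esub> x = I +>\<^bsub>conv_ring\<^esub> y \<longleftrightarrow> x - y \<in> I"
proof -
  have coset: "I +>\<^bsub>conv_ring\<^esub> x = {i + x | i. i \<in> I}" for x
    by (auto simp: a_r_coset_def' conv_ring_simps)
  show ?thesis
  proof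
    assume "I +>\<^bsub>conv_ring\<^esub> x = I +>\<^bsub>conv_ring\<^esub> y"
    moreover have "0 + x \<in> I +>\<^bsub>conv_ring\<^esub> x" using series.subspace_0[OF assms] by (auto simp: coset)
    ultimately obtain i where "i \<in> I" "x = i + y" by (auto simp: coset)
    thus "x - y \<in> I" by simp
  next
    assume xy: "x - y \<in> I"
    have "i + x \<in> {i + y | i. i \<in> I}" if "i \<in> I" for i
      using series.subspace_add[OF assms that xy] by (auto intro!: exI[of _ "i + (x - y)"])
    moreover have "i + y \<in> {i + x | i. i \<in> I}" if "i \<in> I" for i
      using series.subspace_diff[OF assms that xy] by (auto intro!: exI[of _ "i - (x - y)"])
    ultimately show "I +>\<^bsub>conv_ring\<^esub> x = I +>\<^bsub>conv_ring\<^esub> y" unfolding coset by blast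
  qed
qed

text \<open>The residue map \<open>\<pi>\<close> matches the two inductive definitions rule by rule: line extensions of
  \<open>\<pi> E\<close> are images of line extensions of \<open>E\<close>, and a class lies outside \<open>\<pi> E\<close> exactly if its
  representatives lie outside \<open>E\<close>, because \<open>E\<close> contains \<open>I\<close>.\<close>

lemma dimension_quotient_iff:
  assumes ideal: "ideal I conv_ring" and sub: "series.subspace I"
  shows "ring.dimension (conv_ring Quot I) n
      (range (\<lambda>c. I +>\<^bsub>conv_ring\<^esub> fps_const (fps_const c))) (carrier (conv_ring Quot I))
    \<longleftrightarrow> series.rel_dim I n (Collect convergent2)"
proof -
  interpret I: ideal I conv_ring by (rule ideal)
  define \<pi> where "\<pi> = (\<lambda>x. I +>\<^bsub>conv_ring\<^esub> x)"
  define Q where "Q = conv_ring Quot I"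
  define K where "K = range (\<lambda>c. \<pi> (const2 c))"
  interpret Q: ring Q unfolding Q_def by (rule I.quotient_is_ring)
  have eq: "\<pi> x = \<pi> y \<longleftrightarrow> x - y \<in> I" for x y
    unfolding \<pi>_def by (rule coset_eq_iff[OF sub])
  have I_conv: "I \<subseteq> Collect convergent2" using I.a_subset by (simp add: conv_ring_simps)
  have carrier: "carrier Q = \<pi> ` Collect convergent2"
    by (auto simp: Q_def FactRing_def A_RCOSETS_def' \<pi>_def conv_ring_simps)
  have add: "\<pi> x \<oplus>\<^bsub>Q\<^esub> \<pi> y = \<pi> (x + y)" if "convergent2 x" "convergent2 y" for x y
    using that I.a_rcos_sum[of x y] by (simp add: Q_def FactRing_def \<pi>_def conv_ring_simps)
  have mult: "\<pi> x \<otimes>\<^bsub>Q\<^esub> \<pi> y = \<pi> (x * y)" if "convergent2 x" "convergent2 y" for x y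
    using that I.rcoset_mult_add[of x y] by (simp add: Q_def FactRing_def \<pi>_def conv_ring_simps)
  have zero: "{\<zero>\<^bsub>Q\<^esub>} = \<pi> ` I"
  proof -
    have "\<pi> 0 = I" by (auto simp: \<pi>_def a_r_coset_def' conv_ring_simps)
    hence "\<zero>\<^bsub>Q\<^esub> = \<pi> 0" by (simp add: Q_def FactRing_def)
    moreover have "\<pi> ` I = {\<pi> 0}" using series.subspace_0[OF sub] eq[of _ 0] by auto
    ultimately show ?thesis by simp
  qed
  have line: "Q.line_extension K (\<pi> w) (\<pi> ` E) = \<pi> ` {e + const2 c * w | e c. e \<in> E}"
    if "convergent2 w" "E \<subseteq> Collect convergent2" for w E
  proof -
    have "Q.line_extension K (\<pi> w) (\<pi> ` E) = {\<pi> (const2 c) \<otimes>\<^bsub>Q\<^esub> \<pi> w \<oplus>\<^bsub>Q\<^esub> \<pi> e | c e. e \<in> E}"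
      unfolding Q.line_extension_def K_def r_coset_def set_add_def' by auto
    also have "\<dots> = {\<pi> (e + const2 c * w) | c e. e \<in> E}"
    proof -
      have "\<pi> (const2 c) \<otimes>\<^bsub>Q\<^esub> \<pi> w \<oplus>\<^bsub>Q\<^esub> \<pi> e = \<pi> (e + const2 c * w)" if "e \<in> E" for c e
        using that \<open>convergent2 w\<close> \<open>E \<subseteq> _\<close> by (auto simp: add mult convergent2_times add.commute)
      thus ?thesis by (metis (no_types, lifting))
    qed
    also have "\<dots> = \<pi> ` {e + const2 c * w | e c. e \<in> E}" by blast
    finally show ?thesis .
  qed
  have down: "\<exists>E'. E = \<pi> ` E' \<and> series.rel_dim I n E' \<and> E' \<subseteq> Collect convergent2"
    if "Q.dimension n K' E" "K' = K" for n K' E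
    using that
  proof (induction rule: Q.dimension.induct)
    case (zero_dim K')
    show ?case by (intro exI[of _ I]) (use zero I_conv in \<open>blast intro: series.rel_dim.base\<close>)
  next
    case (Suc_dim v E n K')
    then obtain E' where E': "E = \<pi> ` E'" "series.rel_dim I n E'" "E' \<subseteq> Collect convergent2" by blast
    from Suc_dim(1) obtain w where w: "convergent2 w" "v = \<pi> w" by (auto simp: carrier)
    have "w \<notin> E'" using Suc_dim(2) E'(1) w(2) by blast
    hence "series.rel_dim I (Suc n) {e + const2 c * w | e c. e \<in> E'}"
      by (rule series.rel_dim.adjoin[OF E'(2)])
    moreover have "{e + const2 c * w | e c. e \<in> E'} \<subseteq> Collect convergent2"
      using E'(3) w(1) by (auto intro!: convergent2_add convergent2_times)
    ultimately show ?case using line[OF w(1) E'(3)] w(2) E'(1) Suc_dim.prems by blast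
  qed
  have up: "Q.dimension n K (\<pi> ` E)" if "series.rel_dim I n E" "E \<subseteq> Collect convergent2" for n E
    using that
  proof (induction rule: series.rel_dim.induct)
    case base
    show ?case using Q.zero_dim[of K] by (simp only: zero)
  next
    case (adjoin n E w)
    have sE: "series.subspace E" "I \<subseteq> E" using series.rel_dim_subspace[OF adjoin(1) sub] by auto
    have "E \<subseteq> {e + const2 c * w | e c. e \<in> E}" by (rule series.adjoin_superset)
    with adjoin.prems have E: "E \<subseteq> Collect convergent2" by blast
    have w: "convergent2 w" using subsetD[OF adjoin.prems series.adjoin_self[OF sE(1)]] by simp
    have "\<pi> w \<notin> \<pi> ` E"
    proof
      assume "\<pi> w \<in> \<pi> ` E"
      then obtain e where e: "e \<in> E" "w - e \<in> I" using eq[of w] by blast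
      have "(w - e) + e \<in> E" by (rule series.subspace_add[OF sE(1) subsetD[OF sE(2) e(2)] e(1)])
      thus False using adjoin(2) by simp
    qed
    moreover have "\<pi> w \<in> carrier Q" using w unfolding carrier by blast
    ultimately have "Q.dimension (Suc n) K (Q.line_extension K (\<pi> w) (\<pi> ` E))"
      using Q.Suc_dim[OF _ _ adjoin.IH[OF E]] by blast
    thus ?case unfolding line[OF w E] .
  qed
  have "Q.dimension n K (carrier Q) \<longleftrightarrow> series.rel_dim I n (Collect convergent2)"
  proof
    assume "Q.dimension n K (carrier Q)"
    from down[OF this refl] obtain E where
      E: "carrier Q = \<pi> ` E" "series.rel_dim I n E" "E \<subseteq> Collect convergent2" by blast
    have sE: "series.subspace E" "I \<subseteq> E" using series.rel_dim_subspace[OF E(2) sub] by auto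
    have "x \<in> E" if "convergent2 x" for x
    proof -
      have "\<pi> x \<in> \<pi> ` E" using that carrier E(1) by blast
      then obtain e where e: "e \<in> E" "x - e \<in> I" using eq[of x] by blast
      have "(x - e) + e \<in> E" by (rule series.subspace_add[OF sE(1) subsetD[OF sE(2) e(2)] e(1)])
      thus ?thesis by simp
    qed
    with E(3) have "E = Collect convergent2" by blast
    with E(2) show "series.rel_dim I n (Collect convergent2)" by simp
  next
    assume "series.rel_dim I n (Collect convergent2)"
    thus "Q.dimension n K (carrier Q)" unfolding carrier by (rule up) simp
  qed
  thus ?thesis by (simp add: Q_def K_def \<pi>_def const2_def)
qed

lemma intersection_number_eq:
  assumes "convergent2 f" "convergent2 g"
  shows "intersection_number f g =
    (if \<exists>n. series.rel_dim (ideal2 f g) n (Collect convergent2)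
     then enat (THE n. series.rel_dim (ideal2 f g) n (Collect convergent2)) else \<infinity>)"
  unfolding intersection_number_def local_algebra_def local_scalars_def genideal_eq_ideal2[OF assms]
    dimension_quotient_iff[OF ideal_ideal2[OF assms] subspace_ideal2] Let_def ..

lemma intersection_number_eq_enat:
  assumes "convergent2 f" "convergent2 g" "series.rel_dim (ideal2 f g) n (Collect convergent2)"
  shows "intersection_number f g = enat n"
proof -
  have "(THE n. series.rel_dim (ideal2 f g) n (Collect convergent2)) = n"
    using series.rel_dim_unique[OF subspace_ideal2] assms(3) by blast
  thus ?thesis using assms by (auto simp: intersection_number_eq)
qed

text \<open>All elements of \<open>(f, g)\<close> vanish at the origin, so \<open>1\<close> is not among them and the quotient is
  not the zero ring.\<close>

lemma intersection_number_ge_1: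
  assumes "convergent2 f" "convergent2 g" "coeff2 f 0 0 = 0" "coeff2 g 0 0 = 0"
  shows "intersection_number f g \<ge> 1"
proof (cases "\<exists>n. series.rel_dim (ideal2 f g) n (Collect convergent2)")
  case True
  then obtain n where n: "series.rel_dim (ideal2 f g) n (Collect convergent2)" by blast
  have "n \<noteq> 0"
  proof
    assume "n = 0"
    with n have "ideal2 f g = Collect convergent2" by cases auto
    hence "1 \<in> ideal2 f g" by simp
    then obtain a b where "1 = a * f + b * g" by (auto simp: ideal2_def)
    hence "coeff2 1 0 0 = coeff2 (a * f + b * g) 0 0" by simp
    thus False using assms(3,4) by (simp add: coeff2_times)
  qed
  thus ?thesis using intersection_number_eq_enat[OF assms(1,2) n] by (simp add: one_enat_def)
qed (use assms in \<open>simp add: intersection_number_eq\<close>)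

section \<open>Intersection with a curve containing the axis\<close>

text \<open>The powers \<open>x\<^sup>m\<^sup>-\<^sup>1, \<dots>, x, 1\<close> are adjoined successively, each one lowering by one the order to
  which the restriction to the axis has to vanish.\<close>

lemma rel_dim_vanishing_on_axis:
  "series.rel_dim {F. convergent2 F \<and> (\<forall>i<m. coeff2 F i 0 = 0)} m (Collect convergent2)"
proof (induction m)
  case 0
  show ?case by (simp add: series.rel_dim.base)
next
  case (Suc m)
  define A where "A = (\<lambda>m. {F. convergent2 F \<and> (\<forall>i<m. coeff2 F i 0 = 0)})"
  define x where "x = (fps_const (fps_X ^ m) :: complex fps fps)"
  have x: "convergent2 x" unfolding x_def by (rule convergent2_fps_const) simp
  have x_coeff: "coeff2 x i 0 = (if i = m then 1 else 0)" for i by (simp add: x_def)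
  have const2: "coeff2 (const2 c * F) i 0 = c * coeff2 F i 0" for c :: complex and F i
    by (simp add: coeff2_def const2_def)
  have "x \<notin> A (Suc m)" by (simp add: A_def x_coeff)
  from series.rel_dim.adjoin[OF series.rel_dim.base this]
  have "series.rel_dim (A (Suc m)) (Suc 0) {e + const2 c * x | e c. e \<in> A (Suc m)}" .
  also have "{e + const2 c * x | e c. e \<in> A (Suc m)} = A m"
  proof
    show "{e + const2 c * x | e c. e \<in> A (Suc m)} \<subseteq> A m"
      using x by (auto simp: A_def x_coeff const2 intro!: convergent2_add convergent2_times)
    show "A m \<subseteq> {e + const2 c * x | e c. e \<in> A (Suc m)}"
    proof
      fix F assume F: "F \<in> A m"
      define e where "e = F - const2 (coeff2 F m 0) * x"
      have "e \<in> A (Suc m)" using F x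
        by (auto simp: A_def e_def x_coeff const2 less_Suc_eq intro!: convergent2_diff convergent2_times)
      moreover have "F = e + const2 (coeff2 F m 0) * x"
        by (simp add: e_def)
      ultimately show "F \<in> {e + const2 c * x | e c. e \<in> A (Suc m)}" by blast
    qed
  qed
  finally have "series.rel_dim (A (Suc m)) (Suc 0 + m) (Collect convergent2)"
    using Suc.IH by (intro series.rel_dim_trans[of "A m"]) (simp_all add: A_def)
  thus ?case by (simp add: A_def)
qed

text \<open>Modulo \<open>y\<close> a series is its restriction to the axis, and in one variable a convergent series is
  divisible by \<open>f(x, 0)\<close> exactly if its order is at least that of \<open>f(x, 0)\<close>.\<close>

lemma ideal2_y_eq:
  assumes f: "convergent2 f" and nz: "fps_nth f 0 \<noteq> 0"
  shows "ideal2 f fps_X = {F. convergent2 F \<and> (\<forall>i<subdegree (fps_nth f 0). coeff2 F i 0 = 0)}"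
    (is "_ = ?A")
proof
  define m where "m = subdegree (fps_nth f 0)"
  define u where "u = fps_shift m (fps_nth f 0)"
  have f0: "fps_nth f 0 = u * fps_X ^ m" by (simp add: u_def m_def subdegree_decompose')
  have u0: "fps_nth u 0 \<noteq> 0" using nz by (simp add: u_def m_def)
  show "ideal2 f fps_X \<subseteq> ?A"
  proof
    fix F assume "F \<in> ideal2 f fps_X"
    then obtain a b where ab: "convergent2 a" "convergent2 b" "F = a * f + b * fps_X" by (auto simp: ideal2_def)
    have "fps_nth F 0 = (fps_nth a 0 * u) * fps_X ^ m" by (simp add: ab(3) f0 mult_ac)
    hence "coeff2 F i 0 = 0" if "i < m" for i using that by (simp add: coeff2_def fps_X_power_mult_right_nth)
    moreover have "convergent2 F" using ab f by (auto intro!: convergent2_add convergent2_times)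
    ultimately show "F \<in> ?A" by (simp add: m_def)
  qed
  show "?A \<subseteq> ideal2 f fps_X"
  proof
    fix F assume F: "F \<in> ?A"
    define v where "v = fps_shift m (fps_nth F 0)"
    have F0: "fps_nth F 0 = v * fps_X ^ m"
      using F by (auto simp: fps_eq_iff v_def fps_X_power_mult_right_nth coeff2_def m_def)
    \<comment> \<open>The quotient \<open>F(x, 0) / f(x, 0)\<close> after cancelling \<open>x\<^sup>m\<close>; \<open>u\<close> is a unit.\<close>
    define a where "a = fps_const (v * inverse u)"
    have "fps_conv_radius (v * inverse u) > 0"
    proof -
      have "fps_conv_radius (inverse u) > 0"
        using convergent2_row[OF f] u0 by (intro fps_conv_radius_inverse_pos) (simp_all add: u_def)
      moreover have "fps_conv_radius v > 0" using convergent2_row[of F] F by (simp add: v_def)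
      ultimately have "0 < min (fps_conv_radius v) (fps_conv_radius (inverse u))" by simp
      thus ?thesis using fps_conv_radius_mult by (rule order_less_le_trans)
    qed
    hence a: "convergent2 a" unfolding a_def by (rule convergent2_fps_const)
    have "fps_nth (F - a * f) 0 = v * fps_X ^ m - v * (inverse u * u) * fps_X ^ m"
      by (simp add: a_def F0 f0 mult_ac)
    also have "\<dots> = 0" using u0 by (simp add: inverse_mult_eq_1)
    finally have 0: "fps_nth (F - a * f) 0 = 0" .
    define b where "b = fps_shift 1 (F - a * f)"
    have "F - a * f = b * fps_X"
      using 0 by (auto simp: fps_eq_iff b_def)
    hence "F = a * f + b * fps_X" by (simp add: algebra_simps)
    moreover have "convergent2 b" unfolding b_def using F a f
      by (intro convergent2_shift_y convergent2_diff convergent2_times) auto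
    ultimately show "F \<in> ideal2 f fps_X" using a unfolding ideal2_def by blast
  qed
qed

text \<open>Exactness on the left: multiplication by \<open>y\<close> is injective from \<open>R/(f, g)\<close> to \<open>R/(f, y g)\<close>.
  It depends on \<open>f\<close> and \<open>y\<close> having no common factor.\<close>

lemma ideal2_y_mult_quotient:
  assumes f: "convergent2 f" and nz: "fps_nth f 0 \<noteq> 0" and g: "convergent2 g"
  shows "{x \<in> Collect convergent2. fps_X * x \<in> ideal2 f (fps_X * g)} = ideal2 f g"
proof
  show "{x \<in> Collect convergent2. fps_X * x \<in> ideal2 f (fps_X * g)} \<subseteq> ideal2 f g"
  proof
    fix x assume "x \<in> {x \<in> Collect convergent2. fps_X * x \<in> ideal2 f (fps_X * g)}"
    then obtain a b where ab: "convergent2 a" "convergent2 b" "fps_X * x = a * f + b * (fps_X * g)"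
      by (auto simp: ideal2_def)
    have "fps_nth (fps_X * x) 0 = fps_nth (a * f + b * (fps_X * g)) 0" by (simp only: ab(3))
    hence "fps_nth a 0 * fps_nth f 0 = 0" by simp
    hence "fps_nth a 0 = 0" using nz by simp
    hence a: "a = fps_X * fps_shift 1 a" by (auto simp: fps_eq_iff)
    have "fps_X * x = fps_X * (fps_shift 1 a * f + b * g)"
      unfolding ab(3) by (subst a) (simp add: algebra_simps)
    hence "x = fps_shift 1 a * f + b * g" by simp
    thus "x \<in> ideal2 f g" using convergent2_shift_y[OF ab(1)] ab(2) unfolding ideal2_def by blast
  qed
  show "ideal2 f g \<subseteq> {x \<in> Collect convergent2. fps_X * x \<in> ideal2 f (fps_X * g)}"
  proof
    fix x assume x: "x \<in> ideal2 f g"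
    then obtain a b where ab: "convergent2 a" "convergent2 b" "x = a * f + b * g" by (auto simp: ideal2_def)
    have "fps_X * x = (fps_X * a) * f + b * (fps_X * g)" by (simp add: ab(3) algebra_simps)
    moreover have "convergent2 (fps_X * a)" using ab(1) by (simp add: convergent2_times)
    ultimately have "fps_X * x \<in> ideal2 f (fps_X * g)" using ab(2) unfolding ideal2_def by blast
    thus "x \<in> {x \<in> Collect convergent2. fps_X * x \<in> ideal2 f (fps_X * g)}"
      using x ideal2_convergent2[OF f g] by blast
  qed
qed

text \<open>Exactness in the middle: the image of multiplication by \<open>y\<close> in \<open>R/(f, y g)\<close> is the kernel of
  the projection to \<open>R/(f, y)\<close>.\<close>

lemma ideal2_y_mult_sum:
  assumes "convergent2 f" "convergent2 g"
  shows "{i + fps_X * x | i x. i \<in> ideal2 f (fps_X * g) \<and> x \<in> Collect convergent2} = ideal2 f fps_X"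
proof
  show "{i + fps_X * x | i x. i \<in> ideal2 f (fps_X * g) \<and> x \<in> Collect convergent2} \<subseteq> ideal2 f fps_X"
  proof clarify
    fix i x assume "i \<in> ideal2 f (fps_X * g)" "convergent2 x"
    then obtain a b where ab: "convergent2 a" "convergent2 b" "i = a * f + b * (fps_X * g)" by (auto simp: ideal2_def)
    have "i + fps_X * x = a * f + (b * g + x) * fps_X" by (simp add: ab(3) algebra_simps)
    moreover have "convergent2 (b * g + x)"
      using ab assms \<open>convergent2 x\<close> by (auto intro!: convergent2_add convergent2_times)
    ultimately show "i + fps_X * x \<in> ideal2 f fps_X" using ab(1) unfolding ideal2_def by blast
  qed
  show "ideal2 f fps_X \<subseteq> {i + fps_X * x | i x. i \<in> ideal2 f (fps_X * g) \<and> x \<in> Collect convergent2}"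
  proof
    fix z assume "z \<in> ideal2 f fps_X"
    then obtain a b where ab: "convergent2 a" "convergent2 b" "z = a * f + b * fps_X" by (auto simp: ideal2_def)
    have "a * f \<in> ideal2 f (fps_X * g)" using ideal2_times[OF ideal2_generators(1) ab(1)] .
    moreover have "z = a * f + fps_X * b" by (simp add: ab(3) mult.commute)
    ultimately show "z \<in> {i + fps_X * x | i x. i \<in> ideal2 f (fps_X * g) \<and> x \<in> Collect convergent2}"
      using ab(2) by blast
  qed
qed

text \<open>Additivity of dimension along the exact sequence. If \<open>R/(f, g)\<close> is infinite-dimensional, so is
  \<open>R/(f, y g)\<close>, in which it embeds.\<close>

lemma intersection_number_y_mult:
  assumes f: "convergent2 f" and nz: "fps_nth f 0 \<noteq> 0" and g: "convergent2 g"
  shows "intersection_number f (fps_X * g) = fps_ord (fps_nth f 0) + intersection_number f g"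
proof -
  let ?R = "Collect convergent2"
  define m where "m = subdegree (fps_nth f 0)"
  have yg: "convergent2 (fps_X * g)" using g by (simp add: convergent2_times)
  have axis: "series.rel_dim (ideal2 f fps_X) m ?R"
    unfolding ideal2_y_eq[OF f nz] m_def by (rule rel_dim_vanishing_on_axis)
  have ord: "fps_ord (fps_nth f 0) = enat m" using nz by (simp add: fps_ord_def m_def)
  show ?thesis
  proof (cases "\<exists>n. series.rel_dim (ideal2 f g) n ?R")
    case True
    then obtain n where n: "series.rel_dim (ideal2 f g) n ?R" by blast
    have "series.rel_dim {x \<in> ?R. fps_X * x \<in> ideal2 f (fps_X * g)} n ?R"
      using n ideal2_y_mult_quotient[OF f nz g] by simp
    from series.rel_dim_image[OF this order_refl subspace_ideal2 subspace_convergent2 linear_times]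
    have "series.rel_dim (ideal2 f (fps_X * g)) n (ideal2 f fps_X)"
      by (simp only: ideal2_y_mult_sum[OF f g])
    from series.rel_dim_trans[OF axis this] have "intersection_number f (fps_X * g) = enat (n + m)"
      by (rule intersection_number_eq_enat[OF f yg])
    thus ?thesis using intersection_number_eq_enat[OF f g n] by (simp add: ord)
  next
    case False
    have "\<not> series.rel_dim (ideal2 f (fps_X * g)) n ?R" for n
    proof
      assume "series.rel_dim (ideal2 f (fps_X * g)) n ?R"
      from series.rel_dim_vimage[OF this subspace_ideal2 subspace_convergent2 linear_times[of fps_X]]
      obtain k where "series.rel_dim {x \<in> ?R. fps_X * x \<in> ideal2 f (fps_X * g)} k {x \<in> ?R. fps_X * x \<in> ?R}"
        by blast
      moreover have "{x \<in> ?R. fps_X * x \<in> ?R} = ?R" by (auto simp: convergent2_times)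
      ultimately have "series.rel_dim (ideal2 f g) k ?R" using ideal2_y_mult_quotient[OF f nz g] by simp
      thus False using False by blast
    qed
    hence "intersection_number f (fps_X * g) = \<infinity>" "intersection_number f g = \<infinity>"
      using False by (simp_all add: intersection_number_eq f g yg)
    thus ?thesis by simp
  qed
qed

section \<open>Complexification of real series\<close>

lemma coeff2_complexify: "coeff2 (complexify F) i j = of_real (coeff2 F i j)"
  by (simp add: complexify_def coeff2_def)

lemma complexify_y_mult: "complexify (fps_X * F) = fps_X * complexify F"
proof -
  have "coeff2 (complexify (fps_X * F)) i j = coeff2 (fps_X * complexify F) i j" for i j
    by (simp add: coeff2_complexify)
  thus ?thesis by (simp add: fps_eq_iff coeff2_def)
qed

lemma fps_ord_complexify: "fps_ord (fps_nth (complexify F) 0) = fps_ord (fps_nth F 0)"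
proof -
  have c: "fps_nth (fps_nth (complexify F) 0) i = of_real (fps_nth (fps_nth F 0) i)" for i
    using coeff2_complexify[of F i 0] by (simp add: coeff2_def)
  hence "fps_nth (complexify F) 0 = 0 \<longleftrightarrow> fps_nth F 0 = 0" by (simp add: fps_eq_iff)
  thus ?thesis by (simp add: fps_ord_def subdegree_def c)
qed

lemma convergent2_complexify:
  assumes "has_taylor2 f F" shows "convergent2 (complexify F)"
proof -
  obtain C r where "cauchy_bound F C r" using has_taylor2_imp_cauchy_bound[OF assms] by blast
  hence "cauchy_bound (complexify F) C r" by (simp add: cauchy_bound_def coeff2_complexify)
  thus ?thesis unfolding convergent2_iff_cauchy_bound by blast
qed

section \<open>Planar vector fields with an invariant axis\<close>

lemma has_fps_expansion_0_eventually:
  fixes u :: "real \<Rightarrow> real"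
  assumes "u has_fps_expansion 0" shows "\<forall>\<^sub>F x in nhds 0. u x = 0"
proof -
  have "\<forall>\<^sub>F x in nhds 0. eval_fps 0 x = u x" using assms by (simp only: has_fps_expansion_def)
  thus ?thesis by eventually_elim simp
qed

lemma has_fps_expansion_eventually_cong:
  fixes u v :: "real \<Rightarrow> real"
  assumes "\<forall>\<^sub>F x in nhds 0. u x = v x" "u has_fps_expansion U"
  shows "v has_fps_expansion U"
  unfolding has_fps_expansion_def
proof
  show "0 < fps_conv_radius U" using assms(2) by (simp add: has_fps_expansion_def)
  have "\<forall>\<^sub>F x in nhds 0. eval_fps U x = u x" using assms(2) by (simp add: has_fps_expansion_def)
  with assms(1) show "\<forall>\<^sub>F x in nhds 0. eval_fps U x = v x" by eventually_elim simp
qed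

theorem theorem5p1:
  fixes \<Phi> \<Psi> G :: "real^2 \<Rightarrow> real" and X :: "real^2 \<Rightarrow> real^2"
  assumes X: "\<And>p. X p = vector [\<Phi> p, \<Psi> p]"
    and analytic_X: "analytic_at_origin \<Phi>" "analytic_at_origin \<Psi>"
    and analytic_G: "analytic_at_origin G"
    and invariant_axis: "\<forall>\<^sub>F p in nhds 0. \<Psi> p = p $ 2 * G p"
    and equilibrium: "X 0 = 0"
    and nilpotent: "nilpotent_matrix (jacobian X (at 0))"
    and nonzero: "jacobian X (at 0) \<noteq> 0"
    and isolated: "\<forall>\<^sub>F p in at 0. X p \<noteq> 0"
  shows
    \<comment> \<open>(i)\<close>
    "(partial 1 \<Phi> 0 = 0 \<and> partial 2 \<Phi> 0 \<noteq> 0 \<and> G 0 = 0 \<and>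
      {v. jacobian X (at 0) *v v = 0} = span {vector [1, 0]}) \<and>
     \<comment> \<open>(ii)\<close>
     ((\<forall>\<^sub>F x in nhds 0. det (jacobian X (at (vector [x, 0]))) =
        partial 1 \<Phi> (vector [x, 0]) * G (vector [x, 0])) \<and>
      ord_at_0 (\<lambda>x. det (jacobian X (at (vector [x, 0])))) \<ge> 2) \<and>
     \<comment> \<open>(iii)\<close>
     (let q\<^sub>0 = vector [1, 0];
          a = - (1 / 2) * dir_deriv q\<^sub>0 (\<lambda>p. det (jacobian X (at p))) 0;
          b = dir_deriv q\<^sub>0 (\<lambda>p. trace (jacobian X (at p))) 0
      in a = 0 \<and> b = partial 1 (partial 1 \<Phi>) 0 + partial 1 G 0) \<and>
     \<comment> \<open>(iv)\<close>
     (\<mu>\<^sub>0 X = ord_at_0 (\<lambda>x. \<Phi> (vector [x, 0])) + I\<^sub>0 \<Phi> G \<and> \<mu>\<^sub>0 X \<ge> 3)"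
proof -
  obtain f h g where f: "has_taylor2 \<Phi> f" and h: "has_taylor2 \<Psi> h" and g: "has_taylor2 G g"
    using analytic_X analytic_G unfolding analytic_at_origin_def by blast
  have h_eq: "h = fps_X * g"
  proof (rule has_taylor2_unique[OF h])
    have "\<forall>\<^sub>F p in nhds 0. p $ 2 * G p = \<Psi> p" using invariant_axis by eventually_elim simp
    from this has_taylor2_times_y[OF g] show "has_taylor2 \<Psi> (fps_X * g)" by (rule has_taylor2_cong)
  qed
  have X_eq: "X = (\<lambda>p. vector [\<Phi> p, \<Psi> p])" using X by blast
  define \<Phi>x \<Phi>y \<Psi>x \<Psi>y where "\<Phi>x = partial 1 \<Phi>" and "\<Phi>y = partial 2 \<Phi>"
    and "\<Psi>x = partial 1 \<Psi>" and "\<Psi>y = partial 2 \<Psi>"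
  note partials = \<Phi>x_def \<Phi>y_def \<Psi>x_def \<Psi>y_def
  have t\<Phi>x: "has_taylor2 \<Phi>x (deriv_x f)" and t\<Phi>y: "has_taylor2 \<Phi>y (fps_deriv f)"
    and t\<Psi>x: "has_taylor2 \<Psi>x (deriv_x h)" and t\<Psi>y: "has_taylor2 \<Psi>y (fps_deriv h)"
    unfolding partials using f h by (auto intro: has_taylor2_partial_1 has_taylor2_partial_2)
  have jac: "\<forall>\<^sub>F p in nhds 0. jacobian X (at p) = vector [vector [\<Phi>x p, \<Phi>y p], vector [\<Psi>x p, \<Psi>y p]]"
    using has_taylor2_eventually_has_derivative_partial[OF f] has_taylor2_eventually_has_derivative_partial[OF h]
    unfolding X_eq partials by eventually_elim (rule jacobian_vector_2)
  hence jac0: "jacobian X (at 0) = vector [vector [\<Phi>x 0, \<Phi>y 0], vector [\<Psi>x 0, \<Psi>y 0]]"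
    by (rule eventually_nhds_x_imp_x)
  have h_coeff: "coeff2 h i j = (if j = 0 then 0 else coeff2 g i (j - 1))" for i j
    by (simp add: h_eq)
  have at_0: "\<Phi>x 0 = coeff2 f 1 0" "\<Phi>y 0 = coeff2 f 0 1" "\<Psi>x 0 = 0" "\<Psi>y 0 = coeff2 g 0 0" "G 0 = coeff2 g 0 0"
    using has_taylor2_at_0[OF t\<Phi>x] has_taylor2_at_0[OF t\<Phi>y] has_taylor2_at_0[OF t\<Psi>x]
      has_taylor2_at_0[OF t\<Psi>y] has_taylor2_at_0[OF g]
    by (simp_all add: coeff2_deriv_x coeff2_deriv_y h_coeff)
  \<comment> \<open>The matrix at the origin is upper triangular because \<open>\<Psi>\<^sub>x(0) = 0\<close>.\<close>
  have diag: "\<Phi>x 0 = 0" "\<Psi>y 0 = 0"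
    using nilpotent_upper_triangular_2[OF nilpotent] by (simp_all add: jac0 at_0(3))
  have \<Phi>y_nz: "\<Phi>y 0 \<noteq> 0"
    using nonzero by (auto simp: jac0 diag at_0(3) vec_eq_iff forall_2)
  have G0: "G 0 = 0" using diag at_0 by simp
  have "{v. jacobian X (at 0) *v v = 0} = span {vector [1, 0]}"
  proof -
    have "jacobian X (at 0) *v v = 0 \<longleftrightarrow> v $ 2 = 0" for v
      using \<Phi>y_nz by (simp add: jac0 diag at_0(3) matrix_vector_mult_def vec_eq_iff forall_2 sum_2)
    moreover have "v $ 2 = 0 \<longleftrightarrow> (\<exists>k. v = k *\<^sub>R vector [1, 0])" for v :: "real^2"
      by (auto simp: vec_eq_iff forall_2)
    ultimately show ?thesis by (auto simp: span_singleton)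
  qed
  hence part_i: "partial 1 \<Phi> 0 = 0 \<and> partial 2 \<Phi> 0 \<noteq> 0 \<and> G 0 = 0 \<and>
      {v. jacobian X (at 0) *v v = 0} = span {vector [1, 0]}"
    using diag \<Phi>y_nz G0 by (simp add: partials)

  have axis_h: "fps_nth (deriv_x h) 0 = 0" "fps_nth (fps_deriv h) 0 = fps_nth g 0"
    by (simp_all add: h_eq deriv_x_def)
  have "\<forall>\<^sub>F x in nhds 0. \<Psi>x (vector [x, 0]) = 0"
    using has_taylor2_axis[OF t\<Psi>x] unfolding axis_h by (rule has_fps_expansion_0_eventually)
  moreover have "\<forall>\<^sub>F x in nhds 0. \<Psi>y (vector [x, 0]) = G (vector [x, 0])"
  proof -
    have "\<forall>\<^sub>F x in nhds 0. eval_fps (fps_nth g 0) x = \<Psi>y (vector [x, 0])"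
      using has_taylor2_axis[OF t\<Psi>y] unfolding axis_h has_fps_expansion_def by blast
    moreover have "\<forall>\<^sub>F x in nhds 0. eval_fps (fps_nth g 0) x = G (vector [x, 0])"
      using has_taylor2_axis[OF g] unfolding has_fps_expansion_def by blast
    ultimately show ?thesis by eventually_elim simp
  qed
  ultimately have det_axis: "\<forall>\<^sub>F x in nhds 0. det (jacobian X (at (vector [x, 0]))) =
      \<Phi>x (vector [x, 0]) * G (vector [x, 0])"
    using eventually_nhds_axis[OF jac] by eventually_elim (simp add: det_2)
  have ord_det: "ord_at_0 (\<lambda>x. det (jacobian X (at (vector [x, 0])))) \<ge> 2"
  proof -
    let ?D = "fps_nth (deriv_x f) 0 * fps_nth g 0"
    have "(\<lambda>x. \<Phi>x (vector [x, 0]) * G (vector [x, 0])) has_fps_expansion ?D"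
      by (intro has_fps_expansion_mult has_taylor2_axis t\<Phi>x g)
    moreover have "\<forall>\<^sub>F x in nhds 0. \<Phi>x (vector [x, 0]) * G (vector [x, 0]) = det (jacobian X (at (vector [x, 0])))"
      using det_axis by eventually_elim simp
    ultimately have "(\<lambda>x. det (jacobian X (at (vector [x, 0])))) has_fps_expansion ?D"
      by (rule has_fps_expansion_eventually_cong[rotated])
    hence ord: "ord_at_0 (\<lambda>x. det (jacobian X (at (vector [x, 0])))) = fps_ord ?D"
      by (rule ord_at_0_eq)
    have 0: "fps_nth (fps_nth (deriv_x f) 0) 0 = 0" "fps_nth (fps_nth g 0) 0 = 0"
      using at_0 diag G0 coeff2_deriv_x[of f 0 0] by (simp_all add: coeff2_def)
    show ?thesis
    proof (cases "?D = 0")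
      case False
      hence nz: "fps_nth (deriv_x f) 0 \<noteq> 0" "fps_nth g 0 \<noteq> 0" by auto
      hence "1 \<le> subdegree (fps_nth (deriv_x f) 0)" "1 \<le> subdegree (fps_nth g 0)"
        using 0 by (auto intro!: subdegree_geI)
      hence "2 \<le> subdegree ?D" using nz by simp
      thus ?thesis using False by (simp add: ord fps_ord_def numeral_eq_enat)
    qed (simp add: ord fps_ord_def)
  qed

  note d = has_taylor2_has_derivative_at_0[OF t\<Phi>x] has_taylor2_has_derivative_at_0[OF t\<Phi>y]
    has_taylor2_has_derivative_at_0[OF t\<Psi>x] has_taylor2_has_derivative_at_0[OF t\<Psi>y]
  have jac_at: "\<forall>\<^sub>F p in at 0. jacobian X (at p) = vector [vector [\<Phi>x p, \<Phi>y p], vector [\<Psi>x p, \<Psi>y p]]"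
    using jac unfolding eventually_at_filter by eventually_elim simp
  \<comment> \<open>In \<open>\<Phi>\<^sub>x\<^sub>x \<Psi>\<^sub>y + \<Phi>\<^sub>x \<Psi>\<^sub>x\<^sub>y - \<Phi>\<^sub>x\<^sub>y \<Psi>\<^sub>x - \<Phi>\<^sub>y \<Psi>\<^sub>x\<^sub>x\<close> every term vanishes at the origin, the last one
    because \<open>\<Psi>\<close> is zero along the axis.\<close>
  have "dir_deriv (vector [1, 0]) (\<lambda>p. det (jacobian X (at p))) 0 = 0"
  proof -
    have "((\<lambda>p. det (jacobian X (at p))) has_derivative
      (\<lambda>v. (\<Phi>x 0 * (coeff2 (fps_deriv h) 1 0 * v $ 1 + coeff2 (fps_deriv h) 0 1 * v $ 2)
         + (coeff2 (deriv_x f) 1 0 * v $ 1 + coeff2 (deriv_x f) 0 1 * v $ 2) * \<Psi>y 0)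
         - (\<Phi>y 0 * (coeff2 (deriv_x h) 1 0 * v $ 1 + coeff2 (deriv_x h) 0 1 * v $ 2)
         + (coeff2 (fps_deriv f) 1 0 * v $ 1 + coeff2 (fps_deriv f) 0 1 * v $ 2) * \<Psi>x 0))) (at 0)"
    proof (rule has_derivative_transform_eventually)
      show "((\<lambda>p. \<Phi>x p * \<Psi>y p - \<Phi>y p * \<Psi>x p) has_derivative
      (\<lambda>v. (\<Phi>x 0 * (coeff2 (fps_deriv h) 1 0 * v $ 1 + coeff2 (fps_deriv h) 0 1 * v $ 2)
         + (coeff2 (deriv_x f) 1 0 * v $ 1 + coeff2 (deriv_x f) 0 1 * v $ 2) * \<Psi>y 0)
         - (\<Phi>y 0 * (coeff2 (deriv_x h) 1 0 * v $ 1 + coeff2 (deriv_x h) 0 1 * v $ 2)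
         + (coeff2 (fps_deriv f) 1 0 * v $ 1 + coeff2 (fps_deriv f) 0 1 * v $ 2) * \<Psi>x 0))) (at 0)"
        by (intro has_derivative_diff has_derivative_mult d)
      show "\<forall>\<^sub>F p in at 0. \<Phi>x p * \<Psi>y p - \<Phi>y p * \<Psi>x p = det (jacobian X (at p))"
        using jac_at by eventually_elim (simp add: det_2)
      show "\<Phi>x 0 * \<Psi>y 0 - \<Phi>y 0 * \<Psi>x 0 = det (jacobian X (at 0))"
        by (simp add: jac0 det_2)
    qed simp
    from dir_deriv_eq_of_has_derivative[OF this] show ?thesis
      by (simp add: diag at_0(3) coeff2_deriv_x h_coeff)
  qed
  moreover have "dir_deriv (vector [1, 0]) (\<lambda>p. trace (jacobian X (at p))) 0
      = partial 1 (partial 1 \<Phi>) 0 + partial 1 G 0"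
  proof -
    have "((\<lambda>p. trace (jacobian X (at p))) has_derivative
      (\<lambda>v. (coeff2 (deriv_x f) 1 0 * v $ 1 + coeff2 (deriv_x f) 0 1 * v $ 2)
         + (coeff2 (fps_deriv h) 1 0 * v $ 1 + coeff2 (fps_deriv h) 0 1 * v $ 2))) (at 0)"
    proof (rule has_derivative_transform_eventually)
      show "((\<lambda>p. \<Phi>x p + \<Psi>y p) has_derivative
      (\<lambda>v. (coeff2 (deriv_x f) 1 0 * v $ 1 + coeff2 (deriv_x f) 0 1 * v $ 2)
         + (coeff2 (fps_deriv h) 1 0 * v $ 1 + coeff2 (fps_deriv h) 0 1 * v $ 2))) (at 0)"
        by (intro has_derivative_add d)
      show "\<forall>\<^sub>F p in at 0. \<Phi>x p + \<Psi>y p = trace (jacobian X (at p))"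
        using jac_at by eventually_elim (simp add: trace_def sum_2)
      show "\<Phi>x 0 + \<Psi>y 0 = trace (jacobian X (at 0))"
        by (simp add: jac0 trace_def sum_2)
    qed simp
    moreover have "partial 1 (partial 1 \<Phi>) 0 = coeff2 (deriv_x f) 1 0"
      using partial_eq_of_has_derivative[OF d(1), of 1] by (simp add: partials axis_def)
    moreover have "partial 1 G 0 = coeff2 (fps_deriv h) 1 0"
      using partial_eq_of_has_derivative[OF has_taylor2_has_derivative_at_0[OF g], of 1]
      by (simp add: axis_def coeff2_deriv_y h_coeff)
    ultimately show ?thesis by (simp add: dir_deriv_eq_of_has_derivative)
  qed
  ultimately have part_iii: "let q\<^sub>0 = vector [1, 0];
          a = - (1 / 2) * dir_deriv q\<^sub>0 (\<lambda>p. det (jacobian X (at p))) 0;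
          b = dir_deriv q\<^sub>0 (\<lambda>p. trace (jacobian X (at p))) 0
      in a = 0 \<and> b = partial 1 (partial 1 \<Phi>) 0 + partial 1 G 0"
    by (simp add: Let_def)

  \<comment> \<open>Otherwise all points of the axis near the origin would be equilibria.\<close>
  have axis_nz: "fps_nth f 0 \<noteq> 0"
  proof
    assume "fps_nth f 0 = 0"
    hence "\<forall>\<^sub>F x in nhds 0. \<Phi> (vector [x, 0]) = 0"
      using has_taylor2_axis[OF f] by (simp add: has_fps_expansion_0_eventually)
    moreover have "\<forall>\<^sub>F x in nhds 0. \<Psi> (vector [x, 0]) = 0"
      using eventually_nhds_axis[OF invariant_axis] by eventually_elim simp
    moreover have "\<forall>\<^sub>F x in nhds 0. vector [x, 0] \<noteq> (0 :: real^2) \<longrightarrow> X (vector [x, 0]) \<noteq> 0"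
      using isolated unfolding eventually_at_filter by (intro eventually_nhds_axis) simp
    ultimately have "\<forall>\<^sub>F x :: real in nhds 0. x = 0"
      by eventually_elim (auto simp: X vector_0_0 vec_eq_iff forall_2)
    hence "\<forall>\<^sub>F x :: real in at 0. False" unfolding eventually_at_filter by eventually_elim simp
    thus False by simp
  qed
  have taylor: "taylor2 \<Phi> = f" "taylor2 G = g" "taylor2 (\<lambda>p. X p $ 1) = f" "taylor2 (\<lambda>p. X p $ 2) = fps_X * g"
    using f g h by (simp_all add: taylor2_eq X h_eq)
  have cf: "convergent2 (complexify f)" and cg: "convergent2 (complexify g)"
    using f g by (simp_all add: convergent2_complexify)
  have ord: "ord_at_0 (\<lambda>x. \<Phi> (vector [x, 0])) = fps_ord (fps_nth f 0)"
    by (rule ord_at_0_eq[OF has_taylor2_axis[OF f]])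
  have "fps_nth (complexify f) 0 \<noteq> 0"
    using axis_nz fps_ord_complexify[of f] by (auto simp: fps_ord_def split: if_splits)
  from intersection_number_y_mult[OF cf this cg]
  have mu: "\<mu>\<^sub>0 X = ord_at_0 (\<lambda>x. \<Phi> (vector [x, 0])) + I\<^sub>0 \<Phi> G"
    by (simp add: \<mu>\<^sub>0_def I\<^sub>0_def taylor complexify_y_mult fps_ord_complexify ord)
  have f00: "coeff2 f 0 0 = 0"
    using equilibrium has_taylor2_at_0[OF f] by (simp add: X vec_eq_iff forall_2)
  have "2 \<le> subdegree (fps_nth f 0)"
  proof (rule subdegree_geI[OF axis_nz])
    fix i :: nat assume "i < 2"
    hence "i = 0 \<or> i = 1" by auto
    thus "fps_nth (fps_nth f 0) i = 0" using f00 at_0(1) diag(1) by (auto simp: coeff2_def)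
  qed
  hence "2 \<le> ord_at_0 (\<lambda>x. \<Phi> (vector [x, 0]))"
    using axis_nz by (simp add: ord fps_ord_def numeral_eq_enat)
  moreover have "1 \<le> I\<^sub>0 \<Phi> G"
    unfolding I\<^sub>0_def taylor using f00 at_0(5) G0
    by (intro intersection_number_ge_1 cf cg) (simp_all add: coeff2_complexify)
  ultimately have "2 + 1 \<le> \<mu>\<^sub>0 X" unfolding mu by (rule add_mono)
  hence "3 \<le> \<mu>\<^sub>0 X" by simp
  with part_i det_axis ord_det part_iii mu show ?thesis by (simp add: partials)
qed

end
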